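(* (1) For each $\lambda\in\mathbb N$, the set $\{\mathfrak t_{\mathrm{odd}}^{(n)} v^+_{2\lambda+1}\mid 0\le n\le 2\lambda+1\}$ forms the $\imath$-canonical basis for $L(2\lambda+1)$. Moreover, $\mathfrak t_{\mathrm{odd}}^{(n)} v^+_{2\lambda+1}=0$ for $n>2\lambda+1$. (2) The set $\{\mathfrak t_{\mathrm{odd}}^{(n)}\mid n\in\mathbb N\}$ forms the $\imath$-canonical basis for $\mathbf U^\imath$ (of odd parity, i.e. relative to the modules $L(2\lambda+1)$, $\lambda\in\mathbb N$).
   Context: $\mathbb N=\{0,1,2,\dots\}$. $\mathbf U=\mathbf U_q(\mathfrak{sl}_2)$ is the $\mathbb Q(q)$-algebra generated by $E,F,K,K^{-1}$ with relations $KK^{-1}=K^{-1}K=1$, $EF-FE=\frac{K-K^{-1}}{q-q^{-1}}$, $KE=q^2EK$, $KF=q^{-2}FK$. For $n\in\mathbb Z$, $[n]=\frac{q^n-q^{-n}}{q-q^{-1}}$, and $[n]!=[1]\cdots[n]$ for $n\ge 0$; $F^{(n)}=F^n/[n]!$. Put $\check E=q^{-1}EK^{-1}$ and $\mathfrak t=\check E+F$. Here $\mathbf U^\imath$ is the $\mathbb Q(q)$-subalgebra of $\mathbf U$ generated by $\mathfrak t$ (a polynomial algebra in $\mathfrak t$). The $\imath$-divided powers are, for $a\ge 0$, $\mathfrak t_{\mathrm{odd}}^{(2a)}=\frac{1}{[2a]!}\prod_{i=1-a}^{a}(\mathfrak t-[2i-1])$ and $\mathfrak t_{\mathrm{odd}}^{(2a+1)}=\frac{1}{[2a+1]!}\,\mathfrak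 t\prod_{i=1-a}^{a}(\mathfrak t-[2i-1])$. For $\mu\in\mathbb N$, $L(\mu)$ is the simple $\mathbf U$-module of highest weight $\mu$ (dimension $\mu+1$) with highest weight vector $v^+_\mu$ (so $Ev^+_\mu=0$, $Kv^+_\mu=q^\mu v^+_\mu$); it has canonical basis $\{F^{(a)}v^+_\mu\mid 0\le a\le\mu\}$. For $\mu=2\lambda+1$, the bar involution $\psi_\imath$ on $L(\mu)$ is the $\mathbb Q$-linear map with $\psi_\imath(qx)=q^{-1}\psi_\imath(x)$ that fixes $\mathfrak t_{\mathrm{odd}}^{(n)}v^+_\mu$ for all $n\ge 0$ (equivalently, fixes $\mathfrak t^n v^+_\mu$ for all $n\ge 0$). The $\imath$-canonical basis $\{b^\mu_a\}_{0\le a\le\mu}$ of $L(\mu)$ is the basis characterized by: (i) $\psi_\imath(b^\mu_a)=b^\mu_a$; (ii) $b^\mu_a\in F^{(a)}v^+_\mu+\sum_{0\le r\le\mu}q^{-1}\mathbb Z[q^{-1}]F^{(r)}v^+_\mu$. The $\imath$-canonical basis for $\mathbf U^\imath$ of odd parity is the set $\{u_a\mid a\in\mathbb N\}$ where $u_a\in\mathbf U^\imath$ is the unique element with $u_a v^+_{2\lambda+1}=b^{2\lambda+1}_a$ for all sufficiently large $\lambda\in\mathbb N$. *)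

theory Defs
  imports "HOL-Computational_Algebra.Computational_Algebra"
begin

section \<open>The field of rational functions and quantum integers\<close>

type_synonym ratfun = "rat poly fract"

definition q :: ratfun where
  "q = Fract [:0, 1:] 1"

definition qint :: "int \<Rightarrow> ratfun" where
  "qint n = (q powi n - q powi (- n)) / (q - inverse q)"

definition qfact :: "nat \<Rightarrow> ratfun" where
  "qfact n = (\<Prod>i = 1..n. qint (int i))"

text \<open>The set $q^{-1}\mathbb{Z}[q^{-1}]$.\<close>

definition qinv_int_polys :: "ratfun set" where
  "qinv_int_polys = {inverse q * poly (map_poly of_int p) (inverse q) | p :: int poly. True}"


section \<open>The quantum group of \<open>sl\<^sub>2\<close>\<close>

text \<open>
  \<open>uq\<close> is the unital associative algebra over \<open>ratfun\<close> presented by the generators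
  \<open>E, F, K, K\<^sup>-\<^sup>1\<close> and the defining relations: formal algebra expressions modulo the
  congruence generated by the axioms of algebras (the constants being a central copy
  of the ground field) and by the relations.
\<close>

datatype uq_term =
    TConst ratfun
  | TE | TF | TK | TKinv
  | TAdd uq_term uq_term
  | TMult uq_term uq_term

inductive uq_eq :: "uq_term \<Rightarrow> uq_term \<Rightarrow> bool" where
  refl: "uq_eq x x"
| sym: "uq_eq x y \<Longrightarrow> uq_eq y x"
| trans: "uq_eq x y \<Longrightarrow> uq_eq y z \<Longrightarrow> uq_eq x z"
| cong_add: "uq_eq x x' \<Longrightarrow> uq_eq y y' \<Longrightarrow> uq_eq (TAdd x y) (TAdd x' y')"
| cong_mult: "uq_eq x x' \<Longrightarrow> uq_eq y y' \<Longrightarrow> uq_eq (TMult x y) (TMult x' y')"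
| add_assoc: "uq_eq (TAdd (TAdd x y) z) (TAdd x (TAdd y z))"
| add_comm: "uq_eq (TAdd x y) (TAdd y x)"
| add_zero: "uq_eq (TAdd (TConst 0) x) x"
| mult_assoc: "uq_eq (TMult (TMult x y) z) (TMult x (TMult y z))"
| mult_one_left: "uq_eq (TMult (TConst 1) x) x"
| distrib_right: "uq_eq (TMult (TAdd x y) z) (TAdd (TMult x z) (TMult y z))"
| distrib_left: "uq_eq (TMult x (TAdd y z)) (TAdd (TMult x y) (TMult x z))"
| const_add: "uq_eq (TAdd (TConst c) (TConst d)) (TConst (c + d))"
| const_mult: "uq_eq (TMult (TConst c) (TConst d)) (TConst (c * d))"
| const_central: "uq_eq (TMult (TConst c) x) (TMult x (TConst c))"
| add_inverse: "uq_eq (TAdd x (TMult (TConst (- 1)) x)) (TConst 0)"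
| K_Kinv: "uq_eq (TMult TK TKinv) (TConst 1)"
| Kinv_K: "uq_eq (TMult TKinv TK) (TConst 1)"
| E_F: "uq_eq (TAdd (TMult TE TF) (TMult (TConst (- 1)) (TMult TF TE)))
          (TMult (TConst (inverse (q - inverse q))) (TAdd TK (TMult (TConst (- 1)) TKinv)))"
| K_E: "uq_eq (TMult TK TE) (TMult (TConst (q\<^sup>2)) (TMult TE TK))"
| K_F: "uq_eq (TMult TK TF) (TMult (TConst (inverse q ^ 2)) (TMult TF TK))"

quotient_type uq = uq_term / uq_eq
  by (rule equivpI; auto simp: reflp_def symp_def transp_def
        intro: uq_eq.refl uq_eq.sym uq_eq.trans)

text \<open>The evaluation of terms under the counit shows \<open>0 \<noteq> 1\<close> in \<open>uq\<close>.\<close>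

primrec counit_term :: "uq_term \<Rightarrow> ratfun" where
  "counit_term (TConst c) = c"
| "counit_term TE = 0"
| "counit_term TF = 0"
| "counit_term TK = 1"
| "counit_term TKinv = 1"
| "counit_term (TAdd x y) = counit_term x + counit_term y"
| "counit_term (TMult x y) = counit_term x * counit_term y"

lemma counit_term_cong: "uq_eq x y \<Longrightarrow> counit_term x = counit_term y"
  by (induction rule: uq_eq.induct) (simp_all add: algebra_simps)

lift_definition uconst :: "ratfun \<Rightarrow> uq" is TConst .
lift_definition uE :: uq is TE .
lift_definition uF :: uq is TF .
lift_definition uK :: uq is TK .
lift_definition uKinv :: uq is TKinv .

instantiation uq :: ring_1
begin

lift_definition zero_uq :: uq is "TConst 0" .
lift_definition one_uq :: uq is "TConst 1" .
lift_definition plus_uq :: "uq \<Rightarrow> uq \<Rightarrow> uq" is TAdd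
  by (rule uq_eq.cong_add)
lift_definition times_uq :: "uq \<Rightarrow> uq \<Rightarrow> uq" is TMult
  by (rule uq_eq.cong_mult)
lift_definition uminus_uq :: "uq \<Rightarrow> uq" is "TMult (TConst (- 1))"
  by (intro uq_eq.cong_mult uq_eq.refl)
definition minus_uq :: "uq \<Rightarrow> uq \<Rightarrow> uq" where
  "minus_uq x y = x + - y"

instance
proof
  fix a b c :: uq
  show "a + b + c = a + (b + c)" by transfer (rule uq_eq.add_assoc)
  show "a + b = b + a" by transfer (rule uq_eq.add_comm)
  show "0 + a = a" by transfer (rule uq_eq.add_zero)
  show "- a + a = 0"
    by transfer (rule uq_eq.trans[OF uq_eq.add_comm uq_eq.add_inverse])
  show "a - b = a + - b" by (rule minus_uq_def)
  show "a * b * c = a * (b * c)" by transfer (rule uq_eq.mult_assoc)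
  show "1 * a = a" by transfer (rule uq_eq.mult_one_left)
  show "a * 1 = a"
    by transfer
      (rule uq_eq.trans[OF uq_eq.sym[OF uq_eq.const_central] uq_eq.mult_one_left])
  show "(a + b) * c = a * c + b * c" by transfer (rule uq_eq.distrib_right)
  show "a * (b + c) = a * b + a * c" by transfer (rule uq_eq.distrib_left)
  show "(0::uq) \<noteq> 1" by transfer (auto dest: counit_term_cong)
qed

end

lemma uconst_simps:
  "uconst 0 = 0" "uconst 1 = 1"
  "uconst (c + d) = uconst c + uconst d"
  "uconst (c * d) = uconst c * uconst d"
  "uconst (- c) = - uconst c"
  "uconst (c - d) = uconst c - uconst d"
proof -
  have add: "uconst (c + d) = uconst c + uconst d" for c d
    by transfer (rule uq_eq.sym[OF uq_eq.const_add])
  show zero: "uconst 0 = 0" by transfer (rule uq_eq.refl)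
  show "uconst 1 = 1" by transfer (rule uq_eq.refl)
  show "uconst (c + d) = uconst c + uconst d" by (rule add)
  show "uconst (c * d) = uconst c * uconst d"
    by transfer (rule uq_eq.sym[OF uq_eq.const_mult])
  have neg: "uconst (- c) = - uconst c" for c
    using add[of c "- c"] zero by (simp add: eq_neg_iff_add_eq_0 add.commute)
  show "uconst (- c) = - uconst c" by (rule neg)
  show "uconst (c - d) = uconst c - uconst d"
    using add[of c "- d"] neg[of d] by simp
qed

lemma uconst_central: "uconst c * x = x * uconst c"
  by transfer (rule uq_eq.const_central)

lemma uq_relations:
  "uK * uKinv = 1"
  "uKinv * uK = 1"
  "uE * uF - uF * uE = uconst (inverse (q - inverse q)) * (uK - uKinv)"
  "uK * uE = uconst (q\<^sup>2) * (uE * uK)"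
  "uK * uF = uconst (inverse q ^ 2) * (uF * uK)"
proof -
  show "uK * uKinv = 1" by transfer (rule uq_eq.K_Kinv)
  show "uKinv * uK = 1" by transfer (rule uq_eq.Kinv_K)
  show "uE * uF - uF * uE = uconst (inverse (q - inverse q)) * (uK - uKinv)"
    unfolding minus_uq_def by transfer (rule uq_eq.E_F)
  show "uK * uE = uconst (q\<^sup>2) * (uE * uK)" by transfer (rule uq_eq.K_E)
  show "uK * uF = uconst (inverse q ^ 2) * (uF * uK)" by transfer (rule uq_eq.K_F)
qed


section \<open>The subalgebra \<open>U\<^sup>\<iota>\<close> and the \<open>\<iota>\<close>-divided powers\<close>

definition uEcheck :: uq where
  "uEcheck = uconst (inverse q) * uE * uKinv"

definition ut :: uq where
  "ut = uEcheck + uF"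

definition uq_subalgebra :: "uq set \<Rightarrow> bool" where
  "uq_subalgebra A \<longleftrightarrow> range uconst \<subseteq> A \<and>
     (\<forall>x \<in> A. \<forall>y \<in> A. x + y \<in> A \<and> x * y \<in> A)"

definition uiota :: "uq set" where
  "uiota = uq_subalgebra hull {ut}"

definition F_divpow :: "nat \<Rightarrow> uq" where
  "F_divpow n = uconst (inverse (qfact n)) * uF ^ n"

text \<open>With \<open>n = 2a\<close> or \<open>n = 2a + 1\<close>; the product runs over the integers \<open>1 - a, \<dots>, a\<close>.\<close>

definition t_odd :: "nat \<Rightarrow> uq" where
  "t_odd n = (let a = int (n div 2) in
     uconst (inverse (qfact n)) * (if even n then 1 else ut) *
     prod_list (map (\<lambda>i. ut - uconst (qint (2 * i - 1))) [1 - a..a]))"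


section \<open>Modules\<close>

text \<open>
  Modules over \<open>uq\<close> are carried by subspaces of an ambient \<open>ratfun\<close>-vector space, so that
  one type can accommodate the modules \<open>L(\<mu>)\<close> for all \<open>\<mu>\<close>.
\<close>

locale uq_module = vector_space scale
  for scale :: "ratfun \<Rightarrow> 'v::ab_group_add \<Rightarrow> 'v" (infixr \<open>*s\<close> 75) +
  fixes M :: "'v set"
    and act :: "uq \<Rightarrow> 'v \<Rightarrow> 'v" (infixr \<open>\<rhd>\<close> 75)
  assumes subspace_carrier: "subspace M"
    and act_closed: "x \<in> M \<Longrightarrow> u \<rhd> x \<in> M"
    and act_add_right: "x \<in> M \<Longrightarrow> y \<in> M \<Longrightarrow> u \<rhd> (x + y) = u \<rhd> x + u \<rhd> y"
    and act_add_left: "x \<in> M \<Longrightarrow> (u + w) \<rhd> x = u \<rhd> x + w \<rhd> x"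
    and act_mult: "x \<in> M \<Longrightarrow> (u * w) \<rhd> x = u \<rhd> (w \<rhd> x)"
    and act_const: "x \<in> M \<Longrightarrow> uconst c \<rhd> x = c *s x"
begin

definition submodule :: "'v set \<Rightarrow> bool" where
  "submodule N \<longleftrightarrow> subspace N \<and> N \<subseteq> M \<and> (\<forall>u. \<forall>x \<in> N. u \<rhd> x \<in> N)"

definition simple :: bool where
  "simple \<longleftrightarrow> M \<noteq> {0} \<and> (\<forall>N. submodule N \<longrightarrow> N = {0} \<or> N = M)"

end

text \<open>
  The module \<open>L(\<mu>)\<close> with highest weight vector \<open>v\<close>. These axioms determine it up to
  isomorphism (its dimension \<open>\<mu> + 1\<close> is a consequence of them).
\<close>

locale uq_simple_hw = uq_module scale M act
  for scale :: "ratfun \<Rightarrow> 'v::ab_group_add \<Rightarrow> 'v" (infixr \<open>*s\<close> 75)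
    and M :: "'v set"
    and act :: "uq \<Rightarrow> 'v \<Rightarrow> 'v" (infixr \<open>\<rhd>\<close> 75) +
  fixes \<mu> :: nat and v :: 'v
  assumes simple: simple
    and v_in: "v \<in> M"
    and v_nonzero: "v \<noteq> 0"
    and E_v: "uE \<rhd> v = 0"
    and K_v: "uK \<rhd> v = (q ^ \<mu>) *s v"
begin

text \<open>
  The notions below are meant for odd \<open>\<mu>\<close>. Maps and families are only relevant on \<open>M\<close> and
  on \<open>{..\<mu>}\<close> respectively, and uniqueness is understood accordingly.
\<close>

definition bar_map :: "('v \<Rightarrow> 'v) \<Rightarrow> bool" where
  "bar_map \<psi> \<longleftrightarrow>
     (\<forall>x \<in> M. \<psi> x \<in> M) \<and>
     (\<forall>x \<in> M. \<forall>y \<in> M. \<psi> (x + y) = \<psi> x + \<psi> y) \<and>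
     (\<forall>x \<in> M. \<forall>r :: rat. \<psi> (of_rat r *s x) = of_rat r *s \<psi> x) \<and>
     (\<forall>x \<in> M. \<psi> (q *s x) = inverse q *s \<psi> x) \<and>
     (\<forall>n. \<psi> (t_odd n \<rhd> v) = t_odd n \<rhd> v)"

text \<open>\<open>\<psi>\<close> is \<^emph>\<open>the\<close> bar involution.\<close>

definition bar_involution :: "('v \<Rightarrow> 'v) \<Rightarrow> bool" where
  "bar_involution \<psi> \<longleftrightarrow>
     bar_map \<psi> \<and> (\<forall>\<psi>'. bar_map \<psi>' \<longrightarrow> (\<forall>x \<in> M. \<psi>' x = \<psi> x))"

definition icb_conditions :: "('v \<Rightarrow> 'v) \<Rightarrow> (nat \<Rightarrow> 'v) \<Rightarrow> bool" where
  "icb_conditions \<psi> b \<longleftrightarrow>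
     inj_on b {..\<mu>} \<and> independent (b ` {..\<mu>}) \<and> span (b ` {..\<mu>}) = M \<and>
     (\<forall>a \<le> \<mu>. \<psi> (b a) = b a) \<and>
     (\<forall>a \<le> \<mu>. \<exists>c. (\<forall>r \<le> \<mu>. c r \<in> qinv_int_polys) \<and>
        b a = F_divpow a \<rhd> v + (\<Sum>r \<le> \<mu>. c r *s (F_divpow r \<rhd> v)))"

text \<open>\<open>b\<close> is \<^emph>\<open>the\<close> \<open>\<iota>\<close>-canonical basis, as an indexed family.\<close>

definition icanonical_basis :: "(nat \<Rightarrow> 'v) \<Rightarrow> bool" where
  "icanonical_basis b \<longleftrightarrow> (\<exists>\<psi>. bar_involution \<psi> \<and> icb_conditions \<psi> b \<and>
     (\<forall>b'. icb_conditions \<psi> b' \<longrightarrow> (\<forall>a \<le> \<mu>. b' a = b a)))"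

definition icanonical_basis_set :: "'v set \<Rightarrow> bool" where
  "icanonical_basis_set B \<longleftrightarrow> (\<exists>b. icanonical_basis b \<and> B = b ` {..\<mu>})"

end

text \<open>
  \<open>B\<close> is the \<open>\<iota>\<close>-canonical basis of \<open>U\<^sup>\<iota>\<close> of odd parity, where \<open>L \<mu>\<close>, with action \<open>act \<mu>\<close> and
  highest weight vector \<open>v \<mu>\<close>, is the simple module of highest weight \<open>\<mu>\<close>.
  The second conjunct says that \<open>u a\<close> is the unique element of \<open>U\<^sup>\<iota>\<close> that maps the highest
  weight vector of \<open>L(2\<lambda> + 1)\<close> to the \<open>a\<close>-th basis element, for all sufficiently large \<open>\<lambda>\<close>.
\<close>

definition icanonical_basis_uiota_odd ::
  "(ratfun \<Rightarrow> 'v::ab_group_add \<Rightarrow> 'v) \<Rightarrow> (nat \<Rightarrow> 'v set) \<Rightarrow> (nat \<Rightarrow> uq \<Rightarrow> 'v \<Rightarrow> 'v) \<Rightarrow>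
    (nat \<Rightarrow> 'v) \<Rightarrow> uq set \<Rightarrow> bool" where
  "icanonical_basis_uiota_odd scale L act v B \<longleftrightarrow> (\<exists>b u.
     (\<forall>l. uq_simple_hw.icanonical_basis scale (L (2 * l + 1)) (act (2 * l + 1))
        (2 * l + 1) (v (2 * l + 1)) (b l)) \<and>
     (\<forall>a w. w \<in> uiota \<and> (\<forall>\<^sub>F l in sequentially. act (2 * l + 1) w (v (2 * l + 1)) = b l a)
        \<longleftrightarrow> w = u a) \<and>
     B = range u)"

end

theory Submission
  imports Defs
begin

text \<open>
  The theorem rests on a closed formula for the \<open>\<iota>\<close>-divided powers applied to the highest weight
  vector. For \<open>\<mu> = 2 l + 1\<close>, with Gaussian binomials at the base \<open>q\<^sup>-\<^sup>4\<close> and \<open>c = a - k\<close>,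
  the coefficient of \<open>F\<^sup>(\<^sup>2\<^sup>k\<^sup>) v\<close> in \<open>t_odd (2 a) v\<close> is \<open>q\<close> to the power \<open>- c (2 c + 1)\<close> times the
  binomial \<open>l - k\<close> over \<open>c\<close>, and the coefficient of \<open>F\<^sup>(\<^sup>2\<^sup>k\<^sup>+\<^sup>1\<^sup>) v\<close> in \<open>t_odd (2 a + 1) v\<close> is \<open>q\<close> to the
  power \<open>- c (2 c - 1)\<close> times the same binomial (\<open>t_odd_expansion\<close>). It is proved by induction:
  on the one hand \<open>ut\<close> acts on the vectors \<open>F\<^sup>(\<^sup>r\<^sup>) v\<close> by a tridiagonal matrix (\<open>ut_Fv_Suc\<close>), on the
  other hand the \<open>\<iota>\<close>-divided powers satisfy a two-step recurrence under multiplication by \<open>ut\<close>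
  (\<open>ut_t_odd_even\<close>, \<open>ut_t_odd_odd\<close>). Matching the two amounts to two identities between
  neighbouring Gaussian binomials (\<open>coeff_identity_even\<close>, \<open>coeff_identity_odd\<close>).

  Everything in the first part can be read off from the formula. The coefficients other than the
  leading \<open>1\<close> lie in \<open>q\<^sup>-\<^sup>1\<int>[q\<^sup>-\<^sup>1]\<close>, because Gaussian binomials are integral polynomials in
  their base and the exponents are negative for \<open>c > 0\<close>. The binomials vanish when \<open>l < a\<close>, which
  gives \<open>t_odd n v = 0\<close> for \<open>n > \<mu>\<close>. Thus the vectors \<open>t_odd n v\<close> with \<open>n \<le> \<mu>\<close> are a
  unitriangular modification of the basis \<open>F\<^sup>(\<^sup>n\<^sup>) v\<close> of the module, hence a basis, and conjugating
  coordinates in it defines the bar involution (\<open>bar_map_exists\<close>). Any other family with the same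
  properties differs from it by bar-invariant vectors with coefficients in \<open>q\<^sup>-\<^sup>1\<int>[q\<^sup>-\<^sup>1]\<close>,
  and such vectors are \<open>0\<close>, since no nonzero element of \<open>q\<^sup>-\<^sup>1\<int>[q\<^sup>-\<^sup>1]\<close> is invariant
  under \<open>q \<mapsto> q\<^sup>-\<^sup>1\<close> (\<open>bar_fixed_qinv_int_polys\<close>, \<open>bar_fixed_lattice\<close>).

  For the second part, the \<open>\<iota>\<close>-divided powers span \<open>uiota\<close> (\<open>uiota_subset_span\<close>) and finitely many
  of them act independently on the highest weight vector once \<open>l\<close> is large. So an element of
  \<open>uiota\<close> is determined by its action for all large \<open>l\<close>.
\<close>

section \<open>Scalars: transcendence of \<open>q\<close>, quantum integers, bar conjugation\<close>

definition ev :: "ratfun \<Rightarrow> rat poly \<Rightarrow> ratfun" where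
  "ev y p = poly (map_poly of_rat p) y"

lemma ev_pCons: "ev y (pCons a p) = of_rat a + y * ev y p"
  by (simp add: ev_def map_poly_pCons)

lemma ev_0 [simp]: "ev y 0 = 0"
  by (simp add: ev_def)

lemma ev_1 [simp]: "ev y 1 = 1"
  by (simp add: ev_def)

lemma ev_add: "ev y (p + r) = ev y p + ev y r"
proof (induction p arbitrary: r)
  case (pCons a p)
  then show ?case
    by (cases r) (simp add: ev_pCons of_rat_add algebra_simps)
qed simp

lemma ev_smult: "ev y (smult a p) = of_rat a * ev y p"
  by (induction p) (simp_all add: ev_pCons of_rat_mult algebra_simps)

lemma ev_uminus: "ev y (- p) = - ev y p"
  using ev_smult[of y "- 1" p] by simp

lemma ev_mult: "ev y (p * r) = ev y p * ev y r"
  by (induction p) (simp_all add: ev_pCons ev_add ev_smult algebra_simps)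

lemma ev_monom: "ev y (monom 1 n) = y ^ n"
  by (simp add: ev_def map_poly_monom poly_monom)

lemma q_eq: "q = to_fract [:0, 1:]"
  by (simp add: q_def to_fract_def)

text \<open>Makes the constants of \<open>ratfun\<close> explicit as fractions, so that evaluating a polynomial at \<open>q\<close>
  becomes the embedding of polynomials into their fraction field.\<close>

lemma of_rat_ratfun: "(of_rat r :: ratfun) = to_fract [:r:]"
proof -
  have *: "(of_int k :: ratfun) = to_fract [:of_int k:]" for k
  proof (cases k)
    case (nonneg n)
    then show ?thesis
      by (simp add: of_nat_fract to_fract_def of_nat_poly)
  next
    case (neg n)
    then have "(of_int k :: ratfun) = - of_nat (Suc n)" by (metis of_int_minus of_int_of_nat_eq)
    also have "\<dots> = to_fract [:of_int k:]"
      unfolding of_nat_fract to_fract_def of_nat_poly using neg by simp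
    finally show ?thesis .
  qed
  obtain a b where r: "r = Rat.Fract a b" and b: "b > 0" by (cases r) auto
  have "to_fract [:r:] * of_int b = to_fract ([:r:] * [:of_int b:])"
    unfolding * to_fract_mult ..
  also have "[:r:] * [:of_int b:] = [:of_int a:]"
    using b by (simp add: r Fract_of_int_quotient)
  finally have "to_fract [:r:] * of_int b = of_int a" by (simp add: *)
  then have "to_fract [:r:] = of_int a / of_int b"
    using b by (simp add: eq_divide_eq)
  then show ?thesis using b by (simp add: r of_rat_rat)
qed

lemma ev_q: "ev q p = to_fract p"
proof (induction p)
  case (pCons a p)
  have "pCons a p = [:a:] + [:0, 1:] * p" by simp
  then have "to_fract (pCons a p) = to_fract [:a:] + to_fract [:0, 1:] * to_fract p"
    by (metis to_fract_add to_fract_mult)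
  then show ?case using pCons by (simp add: ev_pCons of_rat_ratfun q_eq)
qed simp

lemma ev_q_inj: "ev q p = ev q r \<longleftrightarrow> p = r"
  by (simp add: ev_q)

lemma q_nonzero [simp]: "q \<noteq> 0"
  by (simp add: q_eq)

lemma q_power_inj: "q ^ m = q ^ n \<longleftrightarrow> m = n"
proof -
  have "q ^ m = q ^ n \<longleftrightarrow> monom (1::rat) m = monom 1 n"
    by (metis ev_monom ev_q_inj)
  also have "\<dots> \<longleftrightarrow> m = n" by (metis degree_monom_eq one_neq_zero)
  finally show ?thesis .
qed

lemma q_powi_inj: "q powi m = q powi n \<longleftrightarrow> m = n"
proof -
  have *: "m = 0" if "q powi m = 1" for m
  proof (cases m)
    case (nonneg n)
    then show ?thesis using that q_power_inj[of n 0] by simp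
  next
    case (neg n)
    then have "inverse (q ^ Suc n) = 1" using that
      by (metis power_int_minus power_int_of_nat)
    then have "q ^ Suc n = q ^ 0" by (metis inverse_inverse_eq inverse_1 power_0)
    then show ?thesis using q_power_inj by blast
  qed
  have "q powi m = q powi n \<longleftrightarrow> q powi (m - n) = 1"
    by (auto simp: power_int_diff)
  then show ?thesis using * by fastforce
qed

lemma q_neq_inverse [simp]: "q \<noteq> inverse q"
proof
  assume "q = inverse q"
  then have "q powi 1 = q powi (-1)" unfolding power_int_1_right power_int_minus by simp
  then show False unfolding q_powi_inj by simp
qed

lemma qint_0 [simp]: "qint 0 = 0"
  by (simp add: qint_def)

lemma qint_1 [simp]: "qint 1 = 1"
  by (simp add: qint_def power_int_minus)

lemma qint_minus: "qint (- n) = - qint n"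
  by (simp add: qint_def minus_divide_left)

lemma qint_eq_0_iff [simp]: "qint n = 0 \<longleftrightarrow> n = 0"
  by (simp add: qint_def q_powi_inj)

lemma qfact_0 [simp]: "qfact 0 = 1"
  by (simp add: qfact_def)

lemma qfact_Suc: "qfact (Suc n) = qfact n * qint (int (Suc n))"
  by (simp add: qfact_def)

lemma qfact_nonzero [simp]: "qfact n \<noteq> 0"
  by (induction n) (simp_all add: qfact_Suc del: of_nat_Suc)

lemma q_qint: "qint n * (q - inverse q) = q powi n - inverse (q powi n)"
  by (simp add: qint_def power_int_minus)

text \<open>A polynomial in \<open>q\<^sup>-\<^sup>1\<close> is, up to a power of \<open>q\<close>, the reversed polynomial in \<open>q\<close>; this
  transports the transcendence of \<open>q\<close> to \<open>q\<^sup>-\<^sup>1\<close>.\<close>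

lemma ev_inverse_reflect: "q ^ degree p * ev (inverse q) p = ev q (reflect_poly p)"
proof -
  have deg: "degree (map_poly (of_rat :: rat \<Rightarrow> ratfun) p) = degree p"
    by (cases "p = 0") (simp_all add: map_poly_degree_eq)
  have "map_poly (of_rat :: rat \<Rightarrow> ratfun) (reflect_poly p) = reflect_poly (map_poly of_rat p)"
    by (rule poly_eqI) (simp add: coeff_map_poly coeff_reflect_poly deg)
  then show ?thesis
    by (simp add: ev_def poly_reflect_poly_nz deg)
qed

lemma ev_inverse_q_eq_0_iff: "ev (inverse q) p = 0 \<longleftrightarrow> p = 0"
proof -
  have "ev (inverse q) p = 0 \<longleftrightarrow> ev q (reflect_poly p) = ev q 0"
    by (simp flip: ev_inverse_reflect)
  then show ?thesis by (simp only: ev_q_inj reflect_poly_eq_0_iff)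
qed

text \<open>The field automorphism of \<open>ratfun\<close> that sends \<open>q\<close> to \<open>q\<^sup>-\<^sup>1\<close>. It is given on fractions by
  substituting \<open>q\<^sup>-\<^sup>1\<close> in numerator and denominator, which is possible because \<open>q\<^sup>-\<^sup>1\<close> is
  transcendental.\<close>

definition bar :: "ratfun \<Rightarrow> ratfun" where
  "bar c = (THE d. \<exists>a b. b \<noteq> 0 \<and> c = Fract a b \<and> d = ev (inverse q) a / ev (inverse q) b)"

lemma bar_Fract:
  assumes b: "b \<noteq> 0"
  shows "bar (Fract a b) = ev (inverse q) a / ev (inverse q) b"
  unfolding bar_def
proof (rule the_equality)
  fix d
  assume "\<exists>a' b'. b' \<noteq> 0 \<and> Fract a b = Fract a' b' \<and> d = ev (inverse q) a' / ev (inverse q) b'"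
  then obtain a' b' where *: "b' \<noteq> 0" "Fract a b = Fract a' b'"
    and d: "d = ev (inverse q) a' / ev (inverse q) b'" by blast
  then have "a * b' = a' * b" using b by (simp add: eq_fract)
  then have "ev (inverse q) a * ev (inverse q) b' = ev (inverse q) a' * ev (inverse q) b"
    by (metis ev_mult)
  then show "d = ev (inverse q) a / ev (inverse q) b" using b * d
    by (simp add: frac_eq_eq ev_inverse_q_eq_0_iff)
qed (use b in blast)

lemma bar_ev_q [simp]: "bar (ev q p) = ev (inverse q) p"
  by (simp add: ev_q to_fract_def bar_Fract)

lemma bar_0 [simp]: "bar 0 = 0"
  using bar_ev_q[of 0] by (simp del: bar_ev_q)

lemma bar_1 [simp]: "bar 1 = 1"
  using bar_ev_q[of 1] by (simp del: bar_ev_q)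

lemma bar_add: "bar (c + d) = bar c + bar d"
proof -
  obtain a b a' b' where c: "c = Fract a b" "b \<noteq> 0" and d: "d = Fract a' b'" "b' \<noteq> 0"
    by (cases c, cases d) auto
  then show ?thesis
    by (simp add: bar_Fract ev_add ev_mult ev_inverse_q_eq_0_iff add_frac_eq)
qed

lemma bar_mult: "bar (c * d) = bar c * bar d"
proof -
  obtain a b a' b' where c: "c = Fract a b" "b \<noteq> 0" and d: "d = Fract a' b'" "b' \<noteq> 0"
    by (cases c, cases d) auto
  then show ?thesis by (simp add: bar_Fract ev_mult)
qed

lemma bar_of_rat: "bar (of_rat r) = of_rat r"
  using bar_ev_q[of "[:r:]"] by (simp add: ev_pCons del: bar_ev_q)

lemma bar_q: "bar q = inverse q"
  using bar_ev_q[of "[:0, 1:]"] by (simp add: ev_pCons del: bar_ev_q)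

definition int_polys :: "ratfun set" where
  "int_polys = {poly (map_poly of_int p) (inverse q) | p :: int poly. True}"

lemma int_polys_eq: "int_polys = {ev (inverse q) (map_poly of_int p) | p :: int poly. True}"
  by (simp add: int_polys_def ev_def map_poly_map_poly o_def)

lemma qinv_int_polys_eq: "qinv_int_polys = (\<lambda>c. inverse q * c) ` int_polys"
  by (auto simp: qinv_int_polys_def int_polys_def)

lemma of_int_poly_add: "map_poly (of_int :: int \<Rightarrow> rat) (p + r) = map_poly of_int p + map_poly of_int r"
  by (rule poly_eqI) (simp add: coeff_map_poly)

lemma of_int_poly_minus: "map_poly (of_int :: int \<Rightarrow> rat) (- p) = - map_poly of_int p"
  by (rule poly_eqI) (simp add: coeff_map_poly)

lemma of_int_poly_mult: "map_poly (of_int :: int \<Rightarrow> rat) (p * r) = map_poly of_int p * map_poly of_int r"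
  by (rule poly_eqI) (simp add: coeff_map_poly coeff_mult)

lemma int_polys_add: "c \<in> int_polys \<Longrightarrow> d \<in> int_polys \<Longrightarrow> c + d \<in> int_polys"
  unfolding int_polys_eq by clarify (metis ev_add of_int_poly_add)

lemma int_polys_mult: "c \<in> int_polys \<Longrightarrow> d \<in> int_polys \<Longrightarrow> c * d \<in> int_polys"
  unfolding int_polys_eq by clarify (metis ev_mult of_int_poly_mult)

lemma int_polys_0 [simp]: "0 \<in> int_polys"
  unfolding int_polys_def by (auto intro!: exI[of _ 0])

lemma int_polys_1 [simp]: "1 \<in> int_polys"
  unfolding int_polys_def by (auto intro!: exI[of _ 1])

lemma int_polys_inverse_q [simp]: "inverse q \<in> int_polys"
  unfolding int_polys_def by (auto intro!: exI[of _ "[:0, 1:]"] simp: map_poly_pCons)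

lemma int_polys_power: "c \<in> int_polys \<Longrightarrow> c ^ n \<in> int_polys"
  by (induction n) (auto intro: int_polys_mult)

lemma int_polys_uminus: "c \<in> int_polys \<Longrightarrow> - c \<in> int_polys"
  unfolding int_polys_eq by clarify (metis ev_uminus of_int_poly_minus)

lemma qinv_int_polys_0 [simp]: "0 \<in> qinv_int_polys"
  by (auto simp: qinv_int_polys_eq intro!: image_eqI[of _ _ 0])

lemma qinv_int_polys_diff: "c \<in> qinv_int_polys \<Longrightarrow> d \<in> qinv_int_polys \<Longrightarrow> c - d \<in> qinv_int_polys"
  unfolding qinv_int_polys_eq
  by clarify (metis diff_conv_add_uminus image_eqI int_polys_add int_polys_uminus
      right_diff_distrib)

lemma qinv_int_polys_power_mult:
  assumes "c \<in> int_polys" "0 < n"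
  shows "inverse q ^ n * c \<in> qinv_int_polys"
proof -
  have "inverse q ^ n * c = inverse q * (inverse q ^ (n - 1) * c)"
    using assms(2) by (cases n) simp_all
  then show ?thesis
    using assms(1) by (auto simp: qinv_int_polys_eq intro!: int_polys_mult int_polys_power)
qed

text \<open>The reason why canonical bases are unique: conjugation turns a polynomial in \<open>q\<^sup>-\<^sup>1\<close> without
  constant term into a polynomial in \<open>q\<close> without constant term, and the two kinds meet only in
  \<open>0\<close>. Multiplying by \<open>q\<close> to the degree of \<open>r\<close> makes this a comparison of degrees.\<close>

lemma bar_fixed_qinv_int_polys:
  assumes c: "c \<in> qinv_int_polys" and fixed: "bar c = c"
  shows "c = 0"
proof -
  obtain p :: "int poly" where p: "c = inverse q * ev (inverse q) (map_poly of_int p)"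
    using c by (auto simp: qinv_int_polys_eq int_polys_eq)
  define r where "r = pCons 0 (map_poly (of_int :: int \<Rightarrow> rat) p)"
  have c_r: "c = ev (inverse q) r" by (simp add: p r_def ev_pCons)
  have bar_bar: "bar (ev (inverse q) r) = ev q r" for r
  proof (induction r)
    case (pCons a r)
    have "bar (inverse q) = q"
      using bar_mult[of q "inverse q"] by (simp add: bar_q field_simps)
    then show ?case using pCons by (simp add: ev_pCons bar_add bar_mult bar_of_rat)
  qed simp
  have "ev (inverse q) r = ev q r" using fixed c_r bar_bar by simp
  then have "ev q (reflect_poly r) = ev q (monom 1 (degree r) * r)"
    by (metis ev_inverse_reflect ev_monom ev_mult)
  then have eq: "reflect_poly r = monom 1 (degree r) * r" by (simp only: ev_q_inj)
  have "r = 0"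
  proof (rule ccontr)
    assume r0: "r \<noteq> 0"
    have "degree r + degree r = degree (monom 1 (degree r) * r)"
      using r0 by (simp add: degree_mult_eq degree_monom_eq)
    also have "\<dots> \<le> degree r" using degree_reflect_poly_le[of r] by (simp add: eq)
    finally have "degree r = 0" by simp
    then show False using r0 by (auto simp: r_def split: if_splits)
  qed
  then show ?thesis by (simp add: c_r)
qed


section \<open>Gaussian binomial coefficients\<close>

text \<open>Gaussian binomial coefficients. The Pascal recursion, in place of the usual quotient of
  products, shows that they are polynomials in \<open>p\<close> with integer coefficients.\<close>

fun gauss :: "'a::comm_ring_1 \<Rightarrow> nat \<Rightarrow> nat \<Rightarrow> 'a" where
  "gauss p n 0 = 1"
| "gauss p 0 (Suc c) = 0"
| "gauss p (Suc n) (Suc c) = gauss p n c + p ^ Suc c * gauss p n (Suc c)"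

text \<open>The quotient formula, in the form of the two ratios of neighbouring coefficients that are needed
  to verify recurrences: this lemma and \<open>gauss_shift\<close>.\<close>

lemma gauss_absorb: "(1 - p ^ Suc n) * gauss p n c = (1 - p ^ Suc c) * gauss p (Suc n) (Suc c)"
proof (induction p n c rule: gauss.induct)
  case (1 p n)
  then show ?case by (induction n) (simp_all add: algebra_simps)
next
  case (2 p c)
  then show ?case by simp
next
  case (3 p n c)
  have "(1 - p ^ Suc (Suc c)) * gauss p (Suc (Suc n)) (Suc (Suc c)) =
    (1 - p ^ Suc (Suc c)) * gauss p (Suc n) (Suc c) +
     p ^ Suc (Suc c) * ((1 - p ^ Suc (Suc c)) * gauss p (Suc n) (Suc (Suc c)))"
    by (simp add: algebra_simps)
  also have "(1 - p ^ Suc (Suc c)) * gauss p (Suc n) (Suc (Suc c)) =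
      (1 - p ^ Suc n) * gauss p n (Suc c)"
    using 3(2) by simp
  also have "(1 - p ^ Suc (Suc c)) * gauss p (Suc n) (Suc c) =
     (1 - p) * gauss p (Suc n) (Suc c) + p * ((1 - p ^ Suc c) * gauss p (Suc n) (Suc c))"
    by (simp add: algebra_simps)
  also have "(1 - p ^ Suc c) * gauss p (Suc n) (Suc c) = (1 - p ^ Suc n) * gauss p n c"
    using 3(1) by simp
  finally show ?case by (simp add: algebra_simps)
qed

lemma gauss_shift:
  fixes p :: "'a::field"
  assumes "p \<noteq> 0"
  shows "(1 - p ^ Suc c) * gauss p n (Suc c) = (1 - p ^ n / p ^ c) * gauss p n c"
proof -
  have "p * p ^ c * ((1 - p ^ Suc c) * gauss p n (Suc c)) =
      (1 - p ^ Suc c) * (gauss p (Suc n) (Suc c) - gauss p n c)"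
    by (simp add: algebra_simps)
  also have "\<dots> = (1 - p ^ Suc n) * gauss p n c - (1 - p ^ Suc c) * gauss p n c"
    by (simp only: right_diff_distrib gauss_absorb)
  also have "\<dots> = p * p ^ c * ((1 - p ^ n / p ^ c) * gauss p n c)"
    using assms by (simp add: field_simps)
  finally show ?thesis using assms by (simp only: mult_cancel_left) simp
qed

lemma gauss_int_polys: "p \<in> int_polys \<Longrightarrow> gauss p n c \<in> int_polys"
  by (induction p n c rule: gauss.induct)
    (auto intro!: int_polys_add int_polys_mult int_polys_power)

lemma gauss_eq_0: "n < c \<Longrightarrow> gauss p n c = 0"
  by (induction p n c rule: gauss.induct) auto


section \<open>Recurrences for the \<open>\<iota>\<close>-divided powers\<close>

lemma uq_induct [case_names const E F K Kinv add mult]: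
  assumes "\<And>c. P (uconst c)" "P uE" "P uF" "P uK" "P uKinv"
    and "\<And>x y. P x \<Longrightarrow> P y \<Longrightarrow> P (x + y)" "\<And>x y. P x \<Longrightarrow> P y \<Longrightarrow> P (x * y)"
  shows "P u"
proof (induction u rule: uq.abs_induct)
  case (1 s)
  show ?case
    by (induction s)
      (use assms in \<open>simp_all flip: uconst.abs_eq uE.abs_eq uF.abs_eq uK.abs_eq uKinv.abs_eq
        plus_uq.abs_eq times_uq.abs_eq\<close>)
qed

interpretation uq: vector_space "\<lambda>c x. uconst c * x"
  by standard (simp_all add: uconst_simps algebra_simps)

lemma uconst_left_commute: "x * (uconst c * y) = uconst c * (x * y)"
  by (metis mult.assoc uconst_central)

definition t_prod :: "nat \<Rightarrow> uq" where
  "t_prod a = prod_list (map (\<lambda>i. ut - uconst (qint (2 * i - 1))) [1 - int a..int a])"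

lemma t_odd_even: "t_odd (2 * a) = uconst (inverse (qfact (2 * a))) * t_prod a"
  by (simp add: t_odd_def t_prod_def Let_def)

lemma t_odd_odd: "t_odd (2 * a + 1) = uconst (inverse (qfact (2 * a + 1))) * ut * t_prod a"
  by (simp add: t_odd_def t_prod_def Let_def)

lemma t_prod_commute: "t_prod a * ut = ut * t_prod a"
proof -
  have "prod_list (map (\<lambda>i. ut - uconst (qint (2 * i - 1))) is) * ut
      = ut * prod_list (map (\<lambda>i. ut - uconst (qint (2 * i - 1))) is)" for "is"
    by (induction "is") (simp_all add: left_diff_distrib right_diff_distrib mult.assoc uconst_left_commute[of ut])
  then show ?thesis by (simp add: t_prod_def)
qed

text \<open>The two new factors belong to the indices \<open>- a\<close> and \<open>a + 1\<close>, whose quantum integers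
  \<open>[- 2 a - 1]\<close> and \<open>[2 a + 1]\<close> are opposite.\<close>

lemma t_prod_Suc: "t_prod (Suc a) = (ut * ut - uconst ((qint (2 * int a + 1))\<^sup>2)) * t_prod a"
proof -
  define d where "d = uconst (qint (2 * int a + 1))"
  have dd: "uconst ((qint (2 * int a + 1))\<^sup>2) = d * d"
    by (simp add: d_def power2_eq_square uconst_simps)
  have comm: "x * d = d * x" for x by (simp add: d_def uconst_central)
  have "[1 - int (Suc a)..int (Suc a)] = (- int a) # [1 - int a..int a] @ [int a + 1]"
    by (simp add: upto_rec1[of "- int a"] upto_rec2[of "1 - int a" "1 + int a"] add.commute)
  moreover have "uconst (qint (2 * (- int a) - 1)) = - d"
    using qint_minus[of "2 * int a + 1"] by (simp add: d_def uconst_simps)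
  moreover have "uconst (qint (2 * (int a + 1) - 1)) = d"
    by (simp add: d_def algebra_simps)
  ultimately have "t_prod (Suc a) = (ut + d) * (t_prod a * (ut - d))"
    by (simp add: t_prod_def del: of_nat_Suc)
  also have "t_prod a * (ut - d) = (ut - d) * t_prod a"
    by (simp add: algebra_simps t_prod_commute comm[of "t_prod a"])
  also have "(ut + d) * ((ut - d) * t_prod a) = (ut * ut - d * d) * t_prod a"
    by (simp add: algebra_simps comm[of ut] flip: mult.assoc)
  finally show ?thesis by (simp add: dd)
qed

lemma t_odd_0 [simp]: "t_odd 0 = 1"
  by (simp add: t_odd_def uconst_simps)

lemma ut_t_odd_even: "ut * t_odd (2 * a) = uconst (qint (2 * int a + 1)) * t_odd (2 * a + 1)"
proof -
  have "qfact (2 * a + 1) = qfact (2 * a) * qint (2 * int a + 1)"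
    using qfact_Suc[of "2 * a"] by (simp add: add.commute)
  then have "qint (2 * int a + 1) * inverse (qfact (2 * a + 1)) = inverse (qfact (2 * a))"
    by simp
  then show ?thesis
    unfolding t_odd_even t_odd_odd mult.assoc[symmetric] uconst_simps(4)[symmetric]
    by (simp add: uconst_central)
qed

text \<open>Together with \<open>ut_t_odd_even\<close> this determines all \<open>\<iota>\<close>-divided powers from \<open>t_odd 0 = 1\<close>, so
  it reduces statements on them to the action of \<open>ut\<close> alone.\<close>

lemma ut_t_odd_odd: "ut * t_odd (2 * a + 1) =
    uconst (qint (2 * int a + 2)) * t_odd (2 * a + 2) + uconst (qint (2 * int a + 1)) * t_odd (2 * a)"
proof -
  let ?o = "qint (2 * int a + 1)" and ?e = "qint (2 * int a + 2)"
  let ?i = "inverse (qfact (2 * a + 1))"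
  have nz: "?o \<noteq> 0" "?e \<noteq> 0" by simp_all
  have f1: "qfact (2 * a + 1) = qfact (2 * a) * ?o"
    using qfact_Suc[of "2 * a"] by (simp add: add.commute)
  have f2: "qfact (2 * a + 2) = qfact (2 * a + 1) * ?e"
    using qfact_Suc[of "2 * a + 1"] by (simp add: add.commute)
  have e: "?e * inverse (qfact (2 * a + 2)) = ?i" unfolding f2 using nz by simp
  have o: "?o * inverse (qfact (2 * a)) = ?i * ?o\<^sup>2"
    unfolding f1 using nz by (simp add: power2_eq_square)
  have t2: "t_odd (2 * a + 2) = uconst (inverse (qfact (2 * a + 2))) * t_prod (Suc a)"
    using t_odd_even[of "Suc a"] by simp
  have "uconst ?e * t_odd (2 * a + 2) + uconst ?o * t_odd (2 * a)
      = uconst ?i * t_prod (Suc a) + uconst (?i * ?o\<^sup>2) * t_prod a"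
    unfolding t2 t_odd_even mult.assoc[symmetric] uconst_simps(4)[symmetric] e o ..
  also have "\<dots> = uconst ?i * (ut * ut) * t_prod a"
    unfolding t_prod_Suc uconst_simps(4) by (simp add: algebra_simps)
  also have "\<dots> = ut * t_odd (2 * a + 1)"
    unfolding t_odd_odd by (simp add: mult.assoc uconst_left_commute[of ut])
  finally show ?thesis ..
qed

lemma uq_subalgebra_uiota: "uq_subalgebra uiota"
  unfolding uiota_def by (rule hull_in) (auto simp: uq_subalgebra_def)

lemma t_odd_in_uiota: "t_odd n \<in> uiota"
proof -
  have sub: "uconst c \<in> uiota" "x \<in> uiota \<Longrightarrow> y \<in> uiota \<Longrightarrow> x + y \<in> uiota"
    "x \<in> uiota \<Longrightarrow> y \<in> uiota \<Longrightarrow> x * y \<in> uiota" for c x y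
    using uq_subalgebra_uiota by (auto simp: uq_subalgebra_def)
  have one: "1 \<in> uiota" using sub(1)[of 1] by (simp add: uconst_simps)
  have ut: "ut \<in> uiota" unfolding uiota_def by (rule hull_inc) simp
  have "ut - uconst c \<in> uiota" for c
    using sub(2)[OF ut sub(1)[of "- c"]] by (simp add: uconst_simps)
  then have "prod_list (map (\<lambda>i. ut - uconst (qint (2 * i - 1))) is) \<in> uiota" for "is"
    by (induction "is") (simp_all add: one sub)
  then show ?thesis
    unfolding t_odd_def Let_def using one ut sub by simp
qed

text \<open>The span of the \<open>\<iota>\<close>-divided powers contains \<open>1\<close> and is stable under left multiplication by
  \<open>ut\<close>, by the recurrences. The elements that leave it stable form a subalgebra, so all of
  \<open>uiota\<close> maps \<open>1\<close> into it.\<close>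

lemma uiota_subset_span: "uiota \<subseteq> uq.span (range t_odd)"
proof -
  let ?S = "uq.span (range t_odd)"
  define T where "T = {w. \<forall>s \<in> ?S. w * s \<in> ?S}"
  have ut_t: "ut * t_odd n \<in> ?S" for n
  proof (cases "even n")
    case True
    then obtain a where "n = 2 * a" by blast
    then show ?thesis by (simp only: ut_t_odd_even) (intro uq.span_scale uq.span_base rangeI)
  next
    case False
    then obtain a where "n = 2 * a + 1" using oddE by blast
    then show ?thesis
      by (simp only: ut_t_odd_odd) (intro uq.span_add uq.span_scale uq.span_base rangeI)
  qed
  have "ut * s \<in> ?S" if "s \<in> ?S" for s
    using that
  proof (induction rule: uq.span_induct_alt)
    case base
    then show ?case by (simp add: uq.span_zero)
  next
    case (step c s y)
    then show ?case
      using uq.span_add[OF uq.span_scale[of "ut * s"], of "range t_odd" "ut * y" c] ut_t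
      unfolding semiring_class.distrib_left uconst_left_commute[of ut] by auto
  qed
  moreover have "uq_subalgebra T"
    by (auto simp: uq_subalgebra_def T_def ring_distribs mult.assoc
        intro: uq.span_add uq.span_scale)
  ultimately have "uiota \<subseteq> T"
    unfolding uiota_def by (intro hull_minimal) (auto simp: T_def)
  moreover have "1 \<in> ?S" using uq.span_base[OF rangeI[of t_odd 0]] by simp
  ultimately show ?thesis unfolding T_def by fastforce
qed


section \<open>The simple module of highest weight \<open>\<mu>\<close>\<close>

lemma (in vector_space) span_image_explicit:
  assumes "y \<in> span (f ` S)"
  shows "\<exists>T c. finite T \<and> T \<subseteq> S \<and> y = (\<Sum>r\<in>T. c r *s f r)"
proof -
  obtain A d where A: "finite A" "A \<subseteq> f ` S" "y = (\<Sum>a\<in>A. d a *s a)"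
    using assms unfolding span_explicit by blast
  then obtain T where "T \<subseteq> S" "inj_on f T" "A = f ` T" by (auto simp: subset_image_inj)
  then show ?thesis using A
    by (intro exI[of _ T] exI[of _ "d \<circ> f"]) (auto simp: sum.reindex dest: finite_imageD)
qed

context uq_module
begin

lemma M_simps [simp]:
  "0 \<in> M" "x \<in> M \<Longrightarrow> u \<rhd> x \<in> M" "x \<in> M \<Longrightarrow> c *s x \<in> M"
  "x \<in> M \<Longrightarrow> y \<in> M \<Longrightarrow> x + y \<in> M" "x \<in> M \<Longrightarrow> y \<in> M \<Longrightarrow> x - y \<in> M"
  using subspace_carrier act_closed
  by (auto intro: subspace_0 subspace_scale subspace_add subspace_diff)

lemma M_sum: "(\<And>i. i \<in> I \<Longrightarrow> f i \<in> M) \<Longrightarrow> sum f I \<in> M"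
  by (rule subspace_sum[OF subspace_carrier])

lemma act_scale: "x \<in> M \<Longrightarrow> u \<rhd> (c *s x) = c *s (u \<rhd> x)"
  by (metis act_closed act_const act_mult uconst_central)

lemma act_0_right: "u \<rhd> 0 = 0"
  using act_scale[of 0 u 0] by simp

lemma act_0_left: "x \<in> M \<Longrightarrow> 0 \<rhd> x = 0"
  using act_const[of x 0] by (simp add: uconst_simps)

lemma act_1: "x \<in> M \<Longrightarrow> 1 \<rhd> x = x"
  using act_const[of x 1] by (simp add: uconst_simps)

lemma act_diff_left: "x \<in> M \<Longrightarrow> (u - w) \<rhd> x = u \<rhd> x - w \<rhd> x"
  using act_add_left[of x "u - w" w] by simp

lemma act_sum_right: "(\<And>i. i \<in> I \<Longrightarrow> f i \<in> M) \<Longrightarrow> u \<rhd> sum f I = (\<Sum>i\<in>I. u \<rhd> f i)"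
  by (induction I rule: infinite_finite_induct) (simp_all add: act_0_right act_add_right M_sum)

lemma act_sum_left: "x \<in> M \<Longrightarrow> sum f I \<rhd> x = (\<Sum>i\<in>I. f i \<rhd> x)"
  by (induction I rule: infinite_finite_induct) (simp_all add: act_0_left act_add_left)

lemma act_span_closed:
  assumes "S \<subseteq> M" "\<And>s. s \<in> S \<Longrightarrow> u \<rhd> s \<in> span S" "y \<in> span S"
  shows "u \<rhd> y \<in> span S"
proof -
  have "y \<in> M \<and> u \<rhd> y \<in> span S"
    using assms(3)
  proof (induction rule: span_induct_alt)
    case base
    then show ?case by (simp add: act_0_right span_zero)
  next
    case (step c s y)
    then show ?case using assms(1) assms(2)[of s]
      by (simp add: act_add_right act_scale subset_iff span_add span_scale)
  qed
  then show ?thesis ..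
qed

lemma submodule_span:
  assumes S: "S \<subseteq> M"
    and gen: "\<And>g s. g \<in> {uE, uF, uK, uKinv} \<Longrightarrow> s \<in> S \<Longrightarrow> g \<rhd> s \<in> span S"
  shows "submodule (span S)"
proof -
  have SM: "span S \<subseteq> M" by (rule span_minimal[OF S subspace_carrier])
  have "\<forall>y \<in> span S. u \<rhd> y \<in> span S" for u
  proof (induction u rule: uq_induct)
    case (const c)
    show ?case using SM by (auto simp: act_const span_scale)
  next
    case (add u w)
    then show ?case using SM by (simp add: act_add_left subset_iff span_add)
  next
    case (mult u w)
    then show ?case using SM by (auto simp: act_mult)
  qed (use act_span_closed[OF S] gen in blast)+
  then show ?thesis using SM by (auto simp: submodule_def)
qed

end

context uq_simple_hw
begin

lemma v_M [simp]: "v \<in> M" by (rule v_in)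

text \<open>The canonical basis vectors \<open>F\<^sup>(\<^sup>r\<^sup>) v\<close>. They are defined for all \<open>r\<close>; those beyond \<open>\<mu>\<close> turn out to
  be \<open>0\<close>, so that sums need no upper bound on \<open>r\<close>.\<close>

definition Fv :: "nat \<Rightarrow> 'v" where
  "Fv r = F_divpow r \<rhd> v"

definition wt :: "nat \<Rightarrow> int" where
  "wt r = int \<mu> - 2 * int r"

lemma Fv_in_M [simp]: "Fv r \<in> M"
  by (simp add: Fv_def)

lemma Fv_0: "Fv 0 = v"
  by (simp add: Fv_def F_divpow_def uconst_simps act_1)

lemma F_Fv: "uF \<rhd> Fv r = qint (int r + 1) *s Fv (Suc r)"
proof -
  have "qfact (Suc r) = qfact r * qint (int r + 1)"
    using qfact_Suc[of r] by (simp add: add.commute)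
  then have "inverse (qfact r) = qint (int r + 1) * inverse (qfact (Suc r))"
    by simp
  then have "uF * F_divpow r = uconst (qint (int r + 1)) * F_divpow (Suc r)"
    unfolding F_divpow_def uconst_left_commute[of uF] power_Suc mult.assoc[symmetric]
      uconst_simps(4)[symmetric] by (simp add: uconst_central[of _ uF])
  then have "uF \<rhd> (F_divpow r \<rhd> v) = uconst (qint (int r + 1)) \<rhd> (F_divpow (Suc r) \<rhd> v)"
    by (metis act_mult v_M)
  then show ?thesis by (simp add: Fv_def act_const)
qed

lemma Fv_Suc: "Fv (Suc r) = inverse (qint (int r + 1)) *s (uF \<rhd> Fv r)"
  by (simp add: F_Fv)

lemma K_Fv: "uK \<rhd> Fv r = (q powi wt r) *s Fv r"
proof (induction r)
  case 0
  then show ?case by (simp add: Fv_0 K_v wt_def)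
next
  case (Suc r)
  have "uK \<rhd> (uF \<rhd> Fv r) = (uconst (inverse q ^ 2) * (uF * uK)) \<rhd> Fv r"
    by (metis act_mult Fv_in_M uq_relations(5))
  also have "\<dots> = (inverse q ^ 2 * q powi wt r) *s (uF \<rhd> Fv r)"
    by (simp add: act_mult act_const Suc act_scale)
  also have "inverse q ^ 2 * q powi wt r = q powi wt (Suc r)"
    by (simp add: wt_def power_int_diff power_int_add field_simps power2_eq_square)
  finally have "uK \<rhd> (uF \<rhd> Fv r) = (q powi wt (Suc r)) *s (uF \<rhd> Fv r)" .
  then show ?case by (simp add: Fv_Suc act_scale mult.commute)
qed

lemma Kinv_Fv: "uKinv \<rhd> Fv r = (q powi (- wt r)) *s Fv r"
proof -
  have "Fv r = uKinv \<rhd> (uK \<rhd> Fv r)"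
    by (metis act_1 act_mult Fv_in_M uq_relations(2))
  also have "\<dots> = (q powi wt r) *s (uKinv \<rhd> Fv r)"
    by (simp add: K_Fv act_scale)
  finally have "(q powi (- wt r)) *s Fv r = (q powi (- wt r)) *s (q powi wt r) *s (uKinv \<rhd> Fv r)"
    by simp
  then show ?thesis by (simp add: power_int_minus)
qed

lemma E_F_Fv: "uE \<rhd> (uF \<rhd> Fv r) = uF \<rhd> (uE \<rhd> Fv r) + qint (wt r) *s Fv r"
proof -
  have "uE * uF = uF * uE + uconst (inverse (q - inverse q)) * (uK - uKinv)"
    using uq_relations(3) by (simp add: algebra_simps)
  then have "uE \<rhd> (uF \<rhd> Fv r) =
      uF \<rhd> (uE \<rhd> Fv r) + (uconst (inverse (q - inverse q)) * (uK - uKinv)) \<rhd> Fv r"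
    by (metis act_add_left act_mult Fv_in_M)
  also have "(uconst (inverse (q - inverse q)) * (uK - uKinv)) \<rhd> Fv r = qint (wt r) *s Fv r"
    by (simp add: act_mult act_const act_diff_left K_Fv Kinv_Fv qint_def divide_inverse mult.commute
        flip: scale_left_diff_distrib)
  finally show ?thesis .
qed

lemma qint_E_identity:
  "qint (m - r + 1) * qint r + qint (m - 2 * r) = qint (m - r) * qint (r + 1)"
proof -
  define d where "d = q - inverse q"
  have d: "d \<noteq> 0" by (simp add: d_def)
  define X Y where "X = q powi m" and "Y = q powi r"
  have nz: "X \<noteq> 0" "Y \<noteq> 0" by (simp_all add: X_def Y_def)
  have pw: "qint (m - r + 1) * d = X / Y * q - Y / X / q" "qint r * d = Y - 1 / Y"
     "qint (m - r) * d = X / Y - Y / X" "qint (r + 1) * d = Y * q - 1 / (Y * q)"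
    unfolding d_def q_qint X_def Y_def
    by (simp_all add: power_int_add power_int_diff power_int_minus field_simps mult_2)
  have "q powi (2 * r) = Y * Y" unfolding Y_def mult_2 by (rule power_int_add) simp
  then have pw': "qint (m - 2 * r) * d = X / (Y * Y) - Y * Y / X"
    unfolding d_def q_qint X_def by (simp add: power_int_diff)
  have "(qint (m - r + 1) * qint r + qint (m - 2 * r)) * (d * d) =
      (qint (m - r + 1) * d) * (qint r * d) + (qint (m - 2 * r) * d) * d"
    by (simp add: algebra_simps)
  also have "\<dots> = (qint (m - r) * d) * (qint (r + 1) * d)"
    unfolding pw pw' unfolding d_def using nz by (simp add: field_simps)
  also have "\<dots> = qint (m - r) * qint (r + 1) * (d * d)" by (simp add: algebra_simps)
  finally show ?thesis using d by simp
qed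

lemma E_Fv: "uE \<rhd> Fv (Suc r) = qint (int \<mu> - int r) *s Fv r"
proof (induction r)
  case 0
  then show ?case using E_F_Fv[of 0] by (simp add: Fv_Suc act_scale Fv_0 E_v act_0_right wt_def)
next
  case (Suc r)
  have "uE \<rhd> (uF \<rhd> Fv (Suc r)) = (qint (int \<mu> - int r) * qint (int r + 1) + qint (wt (Suc r))) *s Fv (Suc r)"
    using E_F_Fv[of "Suc r"] by (simp add: Suc act_scale F_Fv scale_left_distrib)
  also have "qint (int \<mu> - int r) * qint (int r + 1) + qint (wt (Suc r)) =
     qint (int \<mu> - int (Suc r)) * qint (int (Suc r) + 1)"
    using qint_E_identity[of "int \<mu>" "int (Suc r)"] by (simp add: wt_def algebra_simps)
  finally show ?case by (simp add: Fv_Suc[of "Suc r"] act_scale)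
qed

text \<open>Weight vectors of distinct weights are independent: \<open>K\<close> minus one eigenvalue removes one term
  and rescales the others by nonzero factors.\<close>

lemma weight_combination_eq_0:
  assumes "finite S" "(\<Sum>r\<in>S. c r *s Fv r) = 0" "r \<in> S"
  shows "c r *s Fv r = 0"
  using assms
proof (induction S arbitrary: c r rule: finite_induct)
  case (insert s S)
  let ?k = "\<lambda>r. q powi wt r"
  let ?d = "\<lambda>r. ?k r - ?k s"
  have "0 = uK \<rhd> (\<Sum>r\<in>insert s S. c r *s Fv r) - ?k s *s (\<Sum>r\<in>insert s S. c r *s Fv r)"
    unfolding insert.prems by (simp add: act_0_right)
  also have "\<dots> = (\<Sum>r\<in>insert s S. (?d r * c r) *s Fv r)"
    by (simp add: act_sum_right act_scale K_Fv scale_sum_right scale_left_diff_distrib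
        algebra_simps flip: sum_subtractf)
  also have "\<dots> = (\<Sum>r\<in>S. (?d r * c r) *s Fv r)"
    using insert.hyps by simp
  finally have *: "(\<Sum>r\<in>S. (?d r * c r) *s Fv r) = 0" by simp
  have S: "c r *s Fv r = 0" if "r \<in> S" for r
  proof -
    have "?d r \<noteq> 0" using that insert.hyps by (auto simp: q_powi_inj wt_def)
    then show ?thesis using insert.IH[OF * that] by auto
  qed
  then have "(\<Sum>r\<in>S. c r *s Fv r) = 0" by (simp add: sum.neutral)
  then have "c s *s Fv s = 0" using insert.prems(1) insert.hyps by simp
  then show ?case using S insert.prems(2) by auto
qed simp

text \<open>Below \<open>Suc \<mu>\<close> the index set may stop, since \<open>E\<close> annihilates \<open>F\<^sup>(\<^sup>\<mu>\<^sup>+\<^sup>1\<^sup>) v\<close>.\<close>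

lemma submodule_span_Fv:
  assumes Suc: "\<And>r. r \<in> R \<Longrightarrow> Suc r \<in> R" and pred: "\<And>r. Suc r \<in> R \<Longrightarrow> r \<in> R \<or> r = \<mu>"
  shows "submodule (span (Fv ` R))"
proof (rule submodule_span)
  have Fv: "Fv r \<in> span (Fv ` R)" if "r \<in> R" for r using that by (simp add: span_base)
  fix g s assume g: "g \<in> {uE, uF, uK, uKinv}" and "s \<in> Fv ` R"
  then obtain r where r: "r \<in> R" "s = Fv r" by blast
  have "uE \<rhd> s \<in> span (Fv ` R)"
  proof (cases r)
    case 0
    then show ?thesis by (simp add: r Fv_0 E_v span_zero)
  next
    case (Suc r')
    then show ?thesis using pred[of r'] r Fv by (auto simp: E_Fv span_zero intro: span_scale)
  qed
  then show "g \<rhd> s \<in> span (Fv ` R)"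
    using g r Suc Fv by (auto simp: F_Fv K_Fv Kinv_Fv intro!: span_scale)
qed auto

lemma Fv_notin_span:
  assumes "Fv n \<noteq> 0" "n \<notin> R"
  shows "Fv n \<notin> span (Fv ` R)"
proof
  assume "Fv n \<in> span (Fv ` R)"
  then obtain T c where T: "finite T" "T \<subseteq> R" "Fv n = (\<Sum>r\<in>T. c r *s Fv r)"
    by (blast dest: span_image_explicit)
  have n: "n \<notin> T" using T(2) assms(2) by blast
  have "(\<Sum>r\<in>T. (c(n := - 1)) r *s Fv r) = (\<Sum>r\<in>T. c r *s Fv r)"
    using n by (intro sum.cong) auto
  then have "(\<Sum>r\<in>insert n T. (c(n := - 1)) r *s Fv r) = - Fv n + (\<Sum>r\<in>T. c r *s Fv r)"
    using T(1) n by simp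
  also have "\<dots> = 0" by (simp flip: T(3))
  finally have "(c(n := - 1)) n *s Fv n = 0"
    by (intro weight_combination_eq_0[of "insert n T"]) (use T in auto)
  then show False using assms by simp
qed

text \<open>The vectors beyond \<open>\<mu>\<close> span a submodule. It does not contain \<open>v\<close>, whose weight is different, so
  it is \<open>0\<close> by simplicity.\<close>

lemma Fv_eq_0:
  assumes "r > \<mu>"
  shows "Fv r = 0"
proof -
  let ?N = "span (Fv ` {\<mu><..})"
  have "submodule ?N" by (rule submodule_span_Fv) auto
  moreover have "v \<notin> ?N" using Fv_notin_span[of 0 "{\<mu><..}"] by (simp add: Fv_0 v_nonzero)
  ultimately have "?N = {0}" using simple unfolding simple_def by (metis v_in)
  then show ?thesis using assms span_base[of "Fv r" "Fv ` {\<mu><..}"] by simp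
qed

lemma Fv_nonzero: "r \<le> \<mu> \<Longrightarrow> Fv r \<noteq> 0"
proof (induction r)
  case 0
  then show ?case by (simp add: Fv_0 v_nonzero)
next
  case (Suc r)
  then have "uE \<rhd> Fv (Suc r) \<noteq> 0" by (simp add: E_Fv)
  then show ?case by (auto simp: act_0_right)
qed

lemma span_Fv: "span (Fv ` {..\<mu>}) = M"
proof -
  have "submodule (span (range Fv))" by (rule submodule_span_Fv) auto
  moreover have "v \<in> span (range Fv)" using span_base[OF rangeI[of Fv 0]] by (simp add: Fv_0)
  ultimately have M: "span (range Fv) = M"
    using simple v_nonzero unfolding simple_def by (metis singletonD)
  have "Fv r \<in> span (Fv ` {..\<mu>})" for r
    by (cases "r \<le> \<mu>") (auto simp: span_base Fv_eq_0 span_zero)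
  then have "span (range Fv) \<subseteq> span (Fv ` {..\<mu>})" by (intro span_minimal) auto
  then show ?thesis using M span_mono[of "Fv ` {..\<mu>}" "range Fv"] by auto
qed

lemma ut_Fv_0: "ut \<rhd> Fv 0 = Fv 1"
  by (simp add: ut_def uEcheck_def act_add_left act_mult act_const Kinv_Fv act_scale F_Fv)
     (simp add: Fv_0 E_v)

text \<open>In the basis of divided powers \<open>ut\<close> is tridiagonal with zero diagonal: \<open>F\<close> raises the index and
  \<open>uEcheck\<close> lowers it.\<close>

lemma ut_Fv_Suc: "ut \<rhd> Fv (Suc r) = qint (int r + 2) *s Fv (r + 2) +
    (q powi (2 * int r + 1 - int \<mu>) * qint (int \<mu> - int r)) *s Fv r"
proof -
  define k where "k = 2 * int r + 1 - int \<mu>"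
  have "- wt (Suc r) = k + 1" by (simp add: wt_def k_def)
  then have "q powi (- wt (Suc r)) * inverse q = q powi k"
    by (simp add: power_int_add_1)
  then have "uEcheck \<rhd> Fv (Suc r) = (q powi k * qint (int \<mu> - int r)) *s Fv r"
    by (simp add: uEcheck_def act_mult act_const Kinv_Fv act_scale E_Fv del: scale_scale)
       (simp flip: mult.assoc)
  then show ?thesis
    by (simp add: ut_def act_add_left F_Fv add.commute k_def)
qed

end


section \<open>The coefficients of the \<open>\<iota>\<close>-divided powers\<close>

text \<open>The base \<open>q\<^sup>-\<^sup>4\<close> arises because \<open>ut\<close> changes the parity of the index, so that the recurrence for
  indices of one parity has steps of two.\<close>

definition gauss4 :: "nat \<Rightarrow> nat \<Rightarrow> ratfun" where
  "gauss4 = gauss (inverse q ^ 4)"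

text \<open>For \<open>\<mu> = 2 l + 1\<close>, the coefficient of \<open>F\<^sup>(\<^sup>2\<^sup>k\<^sup>) v\<close> in \<open>t_odd (2 a) v\<close> is \<open>even_coeff (l - k) (a - k)\<close>,
  and that of \<open>F\<^sup>(\<^sup>2\<^sup>k\<^sup>+\<^sup>1\<^sup>) v\<close> in \<open>t_odd (2 a + 1) v\<close> is \<open>odd_coeff (l - k) (a - k)\<close>. Indexing by the
  differences \<open>m = l - k\<close> and \<open>c = a - k\<close> makes the vanishing for \<open>a > l\<close> that of Gaussian
  binomials with \<open>c > m\<close>.\<close>

definition even_coeff :: "nat \<Rightarrow> nat \<Rightarrow> ratfun" where
  "even_coeff m c = inverse q ^ (c * (2 * c + 1)) * gauss4 m c"

definition odd_coeff :: "nat \<Rightarrow> nat \<Rightarrow> ratfun" where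
  "odd_coeff m c = inverse q ^ (c * (2 * c - 1)) * gauss4 m c"

lemma even_odd_coeff_0 [simp]: "even_coeff m 0 = 1" "odd_coeff m 0 = 1"
  by (simp_all add: even_coeff_def odd_coeff_def gauss4_def)

lemma even_odd_coeff_eq_0: "m < c \<Longrightarrow> even_coeff m c = 0" "m < c \<Longrightarrow> odd_coeff m c = 0"
  by (simp_all add: even_coeff_def odd_coeff_def gauss4_def gauss_eq_0)

lemma gauss4_int_polys: "gauss4 m c \<in> int_polys"
  unfolding gauss4_def by (intro gauss_int_polys int_polys_power int_polys_inverse_q)

text \<open>Here lies the integrality behind the theorem: the exponents of \<open>q\<^sup>-\<^sup>1\<close>, \<open>c (2 c + 1)\<close> and \<open>c (2 c - 1)\<close>,
  are positive for \<open>c > 0\<close>.\<close>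

lemma even_odd_coeff_qinv:
  assumes "0 < c"
  shows "even_coeff m c \<in> qinv_int_polys" "odd_coeff m c \<in> qinv_int_polys"
  unfolding even_coeff_def odd_coeff_def
  by (rule qinv_int_polys_power_mult[OF gauss4_int_polys]; use assms in simp)+

text \<open>This lemma and the two after it express the powers of \<open>q\<close> that occur in a recurrence through a
  single one, which then cancels.\<close>

lemma odd_coeff_even: "inverse q ^ (c * (2 * c - 1)) = inverse q ^ (c * (2 * c + 1)) * q ^ (2 * c)"
proof -
  have "c * (2 * c + 1) = c * (2 * c - 1) + 2 * c" by (cases c) simp_all
  then have "inverse q ^ (c * (2 * c + 1)) = inverse q ^ (c * (2 * c - 1)) * inverse q ^ (2 * c)"
    by (simp only: power_add)
  then show ?thesis by (simp add: power_inverse)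
qed

lemma even_coeff_step: "inverse q ^ (Suc c * (2 * Suc c + 1)) =
    inverse q ^ (c * (2 * c + 1)) * inverse q ^ (4 * c + 3)"
proof -
  have "Suc c * (2 * Suc c + 1) = c * (2 * c + 1) + (4 * c + 3)" by simp
  then show ?thesis by (simp only: power_add)
qed

lemma odd_coeff_step: "inverse q ^ (Suc c * (2 * Suc c - 1)) =
    inverse q ^ (c * (2 * c + 1)) * inverse q ^ (2 * c + 1)"
proof -
  have "Suc c * (2 * Suc c - 1) = c * (2 * c + 1) + (2 * c + 1)" by simp
  then show ?thesis by (simp only: power_add)
qed

lemma qint_nat: "qint (int n) * (q - inverse q) = q ^ n - inverse (q ^ n)"
  by (simp add: q_qint)

lemma q_power_mult: "q ^ (2 * n) = (q ^ n)\<^sup>2" "q ^ (4 * n) = (q ^ n) ^ 4"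
  by (simp_all add: power_mult[symmetric] mult.commute)

lemma gauss_base_power: "(inverse q ^ 4) ^ n = 1 / (q ^ n) ^ 4"
  by (simp add: power_one_over inverse_eq_divide mult.commute flip: power_mult)

lemma gauss_base_power_Suc: "(inverse q ^ 4) ^ Suc n = 1 / ((q ^ n) ^ 4 * q ^ 4)"
  unfolding gauss_base_power by (simp add: power_mult_distrib mult.commute)

text \<open>Comparison of coefficients in \<open>ut * t_odd (2 a) = [2 a + 1] t_odd (2 a + 1)\<close> at
  \<open>F\<^sup>(\<^sup>2\<^sup>k\<^sup>+\<^sup>1\<^sup>) v\<close>, with \<open>l = k + m + 1\<close> and \<open>a = k + c + 1\<close>. After writing everything through
  \<open>X = q\<^sup>k\<close>, \<open>Y = q\<^sup>c\<close>, \<open>Z = q\<^sup>m\<close> and clearing the denominator of the quantum integers, it is a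
  multiple of \<open>gauss_absorb\<close>.\<close>

lemma coeff_identity_even:
  "qint (int (2 * k + 1)) * even_coeff (Suc m) (Suc c) +
     q powi (2 * int k - 2 * int m) * qint (int (2 * m + 2)) * even_coeff m c =
   qint (int (2 * k + 2 * c + 3)) * odd_coeff (Suc m) (Suc c)"
proof -
  define d where "d = q - inverse q"
  define X Y Z where "X = q ^ k" and "Y = q ^ c" and "Z = q ^ m"
  define e g0 g1 where "e = inverse q ^ (c * (2 * c + 1))" and "g0 = gauss4 m c" and "g1 = gauss4 (Suc m) (Suc c)"
  have nz [simp]: "X \<noteq> 0" "Y \<noteq> 0" "Z \<noteq> 0" "d \<noteq> 0" by (simp_all add: X_def Y_def Z_def d_def)
  have pw: "q powi (2 * int k - 2 * int m) = X\<^sup>2 / Z\<^sup>2"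
  proof -
    have "q powi (2 * int k - 2 * int m) = q powi int (2 * k) / q powi int (2 * m)"
      by (simp add: power_int_diff)
    then show ?thesis by (simp only: power_int_of_nat q_power_mult X_def Z_def)
  qed
  have qi: "qint (int (2 * k + 1)) * d = X\<^sup>2 * q - 1 / (X\<^sup>2 * q)"
    "qint (int (2 * m + 2)) * d = Z\<^sup>2 * q\<^sup>2 - 1 / (Z\<^sup>2 * q\<^sup>2)"
    "qint (int (2 * k + 2 * c + 3)) * d = X\<^sup>2 * Y\<^sup>2 * q ^ 3 - 1 / (X\<^sup>2 * Y\<^sup>2 * q ^ 3)"
    unfolding d_def qint_nat power_add q_power_mult X_def Y_def Z_def
    by (simp_all add: inverse_eq_divide power2_eq_square power3_eq_cube mult_ac)
  have ec: "even_coeff (Suc m) (Suc c) = e * (1 / (Y ^ 4 * q ^ 3)) * g1"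
    "odd_coeff (Suc m) (Suc c) = e * (1 / (Y\<^sup>2 * q)) * g1" "even_coeff m c = e * g0"
    unfolding even_coeff_def odd_coeff_def even_coeff_step odd_coeff_step
    by (simp_all add: e_def g1_def g0_def Y_def power_add q_power_mult inverse_eq_divide power_one_over)
  have ab: "(1 - 1 / (Z ^ 4 * q ^ 4)) * g0 = (1 - 1 / (Y ^ 4 * q ^ 4)) * g1"
    using gauss_absorb[of "inverse q ^ 4" m c] by (simp only: gauss_base_power_Suc gauss4_def g0_def g1_def Y_def Z_def)
  have "(qint (int (2 * k + 1)) * even_coeff (Suc m) (Suc c) +
     q powi (2 * int k - 2 * int m) * qint (int (2 * m + 2)) * even_coeff m c) * d =
     e * ((qint (int (2 * k + 1)) * d) * (1 / (Y ^ 4 * q ^ 3)) * g1 +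
       (X\<^sup>2 / Z\<^sup>2) * ((qint (int (2 * m + 2)) * d) * g0))"
    unfolding ec pw by (simp add: algebra_simps)
  also have "(X\<^sup>2 / Z\<^sup>2) * ((qint (int (2 * m + 2)) * d) * g0) =
      X\<^sup>2 * q\<^sup>2 * ((1 - 1 / (Z ^ 4 * q ^ 4)) * g0)"
    unfolding qi by (simp add: field_simps power2_eq_square power4_eq_xxxx)
  also have "\<dots> = X\<^sup>2 * q\<^sup>2 * ((1 - 1 / (Y ^ 4 * q ^ 4)) * g1)" by (simp only: ab)
  also have "(qint (int (2 * k + 1)) * d) * (1 / (Y ^ 4 * q ^ 3)) * g1 + \<dots> =
      (qint (int (2 * k + 2 * c + 3)) * d) * (1 / (Y\<^sup>2 * q)) * g1"
    unfolding qi by (simp add: field_simps power2_eq_square power3_eq_cube power4_eq_xxxx)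
  also have "e * \<dots> = (qint (int (2 * k + 2 * c + 3)) * odd_coeff (Suc m) (Suc c)) * d"
    unfolding ec by (simp add: algebra_simps)
  finally show ?thesis by simp
qed

text \<open>Comparison of coefficients in
  \<open>ut * t_odd (2 a + 1) = [2 a + 2] t_odd (2 a + 2) + [2 a + 1] t_odd (2 a)\<close> at \<open>F\<^sup>(\<^sup>2\<^sup>k\<^sup>) v\<close>, with
  \<open>l = k + m\<close> and \<open>a = k + c\<close>. The Pascal rule removes the binomial of index \<open>Suc m\<close>; what remains
  is a multiple of \<open>gauss_shift\<close>.\<close>

lemma coeff_identity_odd:
  "qint (int (2 * k)) * odd_coeff (Suc m) (Suc c) +
     q powi (2 * int k - 2 * int m) * qint (int (2 * m + 1)) * odd_coeff m c =
   qint (int (2 * k + 2 * c + 2)) * even_coeff m (Suc c) + qint (int (2 * k + 2 * c + 1)) * even_coeff m c"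
proof -
  define d where "d = q - inverse q"
  define X Y Z where "X = q ^ k" and "Y = q ^ c" and "Z = q ^ m"
  define e g h where "e = inverse q ^ (c * (2 * c + 1))" and "g = gauss4 m c" and "h = gauss4 m (Suc c)"
  have nz [simp]: "X \<noteq> 0" "Y \<noteq> 0" "Z \<noteq> 0" "d \<noteq> 0" by (simp_all add: X_def Y_def Z_def d_def)
  have pw: "q powi (2 * int k - 2 * int m) = X\<^sup>2 / Z\<^sup>2"
  proof -
    have "q powi (2 * int k - 2 * int m) = q powi int (2 * k) / q powi int (2 * m)"
      by (simp add: power_int_diff)
    then show ?thesis by (simp only: power_int_of_nat q_power_mult X_def Z_def)
  qed
  have qi: "qint (int (2 * k)) * d = X\<^sup>2 - 1 / X\<^sup>2"
    "qint (int (2 * m + 1)) * d = Z\<^sup>2 * q - 1 / (Z\<^sup>2 * q)"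
    "qint (int (2 * k + 2 * c + 2)) * d = X\<^sup>2 * Y\<^sup>2 * q\<^sup>2 - 1 / (X\<^sup>2 * Y\<^sup>2 * q\<^sup>2)"
    "qint (int (2 * k + 2 * c + 1)) * d = X\<^sup>2 * Y\<^sup>2 * q - 1 / (X\<^sup>2 * Y\<^sup>2 * q)"
    unfolding d_def qint_nat power_add q_power_mult X_def Y_def Z_def
    by (simp_all add: inverse_eq_divide power2_eq_square power3_eq_cube mult_ac)
  have pascal: "gauss4 (Suc m) (Suc c) = g + 1 / (Y ^ 4 * q ^ 4) * h"
    using gauss_base_power_Suc[of c] by (simp only: gauss4_def g_def h_def Y_def gauss.simps)
  have ec: "odd_coeff (Suc m) (Suc c) = e * (1 / (Y\<^sup>2 * q)) * (g + 1 / (Y ^ 4 * q ^ 4) * h)"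
    unfolding odd_coeff_def odd_coeff_step pascal
    by (simp add: e_def Y_def power_add q_power_mult inverse_eq_divide power_one_over)
  have ec': "odd_coeff m c = e * Y\<^sup>2 * g"
    unfolding odd_coeff_def odd_coeff_even by (simp add: e_def g_def Y_def q_power_mult)
  have ec'': "even_coeff m (Suc c) = e * (1 / (Y ^ 4 * q ^ 3)) * h" "even_coeff m c = e * g"
    unfolding even_coeff_def even_coeff_step
    by (simp_all add: e_def g_def h_def Y_def power_add q_power_mult inverse_eq_divide power_one_over)
  have "(1 - 1 / (Y ^ 4 * q ^ 4)) * h = (1 - 1 / Z ^ 4 / (1 / Y ^ 4)) * g"
    using gauss_shift[of "inverse q ^ 4" c m] unfolding gauss_base_power_Suc unfolding gauss_base_power
    by (simp add: gauss4_def g_def h_def Y_def Z_def)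
  then have sh: "X\<^sup>2 / (Y\<^sup>2 * q) * ((1 - 1 / (Y ^ 4 * q ^ 4)) * h) =
     X\<^sup>2 / (Y\<^sup>2 * q) * ((1 - Y ^ 4 / Z ^ 4) * g)" by simp
  have "(qint (int (2 * k)) * odd_coeff (Suc m) (Suc c) +
     q powi (2 * int k - 2 * int m) * qint (int (2 * m + 1)) * odd_coeff m c
     - qint (int (2 * k + 2 * c + 2)) * even_coeff m (Suc c) - qint (int (2 * k + 2 * c + 1)) * even_coeff m c) * d =
     e * ((qint (int (2 * k)) * d) * (1 / (Y\<^sup>2 * q)) * (g + 1 / (Y ^ 4 * q ^ 4) * h) +
      X\<^sup>2 / Z\<^sup>2 * (qint (int (2 * m + 1)) * d) * Y\<^sup>2 * g
      - (qint (int (2 * k + 2 * c + 2)) * d) * (1 / (Y ^ 4 * q ^ 3)) * h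
      - (qint (int (2 * k + 2 * c + 1)) * d) * g)"
    unfolding ec ec' ec'' pw by (simp add: algebra_simps add_divide_distrib)
  also have "\<dots> = e * (X\<^sup>2 / (Y\<^sup>2 * q) * ((1 - Y ^ 4 / Z ^ 4) * g)
        - X\<^sup>2 / (Y\<^sup>2 * q) * ((1 - 1 / (Y ^ 4 * q ^ 4)) * h))"
    unfolding qi
    by (simp add: field_simps power2_eq_square power3_eq_cube power4_eq_xxxx)
  also have "\<dots> = 0" unfolding sh by simp
  finally show ?thesis by simp
qed


section \<open>Expansion of the \<open>\<iota>\<close>-divided powers in the canonical basis\<close>

context uq_simple_hw
begin

text \<open>The coefficient of \<open>Fv r\<close> in \<open>ut \<rhd> Fv (Suc r)\<close>.\<close>

definition down_coeff :: "nat \<Rightarrow> ratfun" where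
  "down_coeff r = q powi (2 * int r + 1 - int \<mu>) * qint (int \<mu> - int r)"

lemma ut_even_sum:
  "ut \<rhd> (\<Sum>k\<le>a. c k *s Fv (2 * k)) =
    (\<Sum>k\<le>a. (qint (int (2 * k + 1)) * c k) *s Fv (2 * k + 1)) +
    (\<Sum>k<a. (down_coeff (2 * k + 1) * c (Suc k)) *s Fv (2 * k + 1))"
proof (induction a)
  case 0
  have "ut \<rhd> Fv 0 = Fv 1" by (rule ut_Fv_0)
  then show ?case by (simp add: act_scale)
next
  case (Suc a)
  have "ut \<rhd> Fv (2 * Suc a) = qint (int (2 * Suc a + 1)) *s Fv (2 * Suc a + 1) + down_coeff (2 * a + 1) *s Fv (2 * a + 1)"
    using ut_Fv_Suc[of "2 * a + 1"] by (simp add: down_coeff_def algebra_simps)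
  then show ?case using Suc
    by (simp add: act_add_right act_scale M_sum scale_right_distrib mult.commute algebra_simps)
qed

lemma ut_odd_sum:
  "ut \<rhd> (\<Sum>k\<le>a. c k *s Fv (2 * k + 1)) =
    (\<Sum>k\<le>a. (qint (int (2 * k + 2)) * c k) *s Fv (2 * k + 2)) +
    (\<Sum>k\<le>a. (down_coeff (2 * k) * c k) *s Fv (2 * k))"
proof -
  have *: "ut \<rhd> Fv (2 * k + 1) = qint (int (2 * k + 2)) *s Fv (2 * k + 2) + down_coeff (2 * k) *s Fv (2 * k)" for k
    using ut_Fv_Suc[of "2 * k"] by (simp add: down_coeff_def algebra_simps)
  have "ut \<rhd> (\<Sum>k\<le>a. c k *s Fv (2 * k + 1)) = (\<Sum>k\<le>a. c k *s (ut \<rhd> Fv (2 * k + 1)))"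
    by (simp add: act_sum_right act_scale)
  then show ?thesis
    unfolding * by (simp add: scale_right_distrib sum.distrib mult.commute)
qed

text \<open>The closed formula. Both families of sums satisfy the recurrences of the \<open>\<iota>\<close>-divided powers,
  coefficient by coefficient. For \<open>k > l\<close> the differences \<open>l - k\<close> are cut off at \<open>0\<close>, which does no
  harm because \<open>F\<^sup>(\<^sup>2\<^sup>k\<^sup>) v\<close> and \<open>F\<^sup>(\<^sup>2\<^sup>k\<^sup>+\<^sup>1\<^sup>) v\<close> vanish.\<close>

lemma t_odd_expansion:
  assumes \<mu>: "\<mu> = 2 * l + 1"
  shows "t_odd (2 * a) \<rhd> v = (\<Sum>k\<le>a. even_coeff (l - k) (a - k) *s Fv (2 * k))"
    and "t_odd (2 * a + 1) \<rhd> v = (\<Sum>k\<le>a. odd_coeff (l - k) (a - k) *s Fv (2 * k + 1))"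
proof -
  let ?e = "\<lambda>a k. even_coeff (l - k) (a - k)" and ?o = "\<lambda>a k. odd_coeff (l - k) (a - k)"
  define S T where "S a = (\<Sum>k\<le>a. ?e a k *s Fv (2 * k))"
    and "T a = (\<Sum>k\<le>a. ?o a k *s Fv (2 * k + 1))" for a
  have down_coeff_l: "down_coeff r = q powi (2 * int r - 2 * int l) * qint (1 + 2 * int l - int r)" for r
    unfolding down_coeff_def by (simp add: \<mu>)
  have even_step: "ut \<rhd> S a = qint (int (2 * a + 1)) *s T a" for a
  proof -
    have *: "(qint (int (2 * k + 1)) * ?e a k + down_coeff (2 * k + 1) * ?e a (Suc k)) *s Fv (2 * k + 1)
        = (qint (int (2 * a + 1)) * ?o a k) *s Fv (2 * k + 1)" if ka: "k < a" for k
    proof -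
      consider "l < k" | "k = l" | "k < l" by linarith
      then show ?thesis
      proof cases
        case 1
        then show ?thesis by (simp add: Fv_eq_0 \<mu>)
      next
        case 2
        \<comment> \<open>\<open>Fv (2 * l + 1)\<close> is the lowest weight vector, so nothing comes down to it.\<close>
        then have "down_coeff (2 * k + 1) = 0" by (simp add: down_coeff_l)
        then show ?thesis using 2 ka by (simp add: even_odd_coeff_eq_0)
      next
        case 3
        then obtain m where l: "l = Suc (k + m)" using less_imp_Suc_add by blast
        obtain c where a: "a = Suc (k + c)" using ka less_imp_Suc_add by blast
        have "down_coeff (2 * k + 1) = q powi (2 * int k - 2 * int m) * qint (int (2 * m + 2))"
          unfolding down_coeff_l l by (simp add: algebra_simps)
        then show ?thesis
          using coeff_identity_even[of k m c] unfolding l a by (simp add: add_ac)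
      qed
    qed
    have "ut \<rhd> S a = (\<Sum>k<a. (qint (int (2 * k + 1)) * ?e a k + down_coeff (2 * k + 1) * ?e a (Suc k)) *s Fv (2 * k + 1))
       + qint (int (2 * a + 1)) *s Fv (2 * a + 1)"
      unfolding S_def ut_even_sum
      by (simp add: lessThan_Suc_atMost[symmetric] scale_left_distrib sum.distrib)
    also have "(\<Sum>k<a. (qint (int (2 * k + 1)) * ?e a k + down_coeff (2 * k + 1) * ?e a (Suc k)) *s Fv (2 * k + 1))
        = (\<Sum>k<a. (qint (int (2 * a + 1)) * ?o a k) *s Fv (2 * k + 1))"
      by (intro sum.cong * HOL.refl) simp
    also have "\<dots> + qint (int (2 * a + 1)) *s Fv (2 * a + 1) = qint (int (2 * a + 1)) *s T a"
      by (simp add: T_def lessThan_Suc_atMost[symmetric] scale_right_distrib scale_sum_right)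
    finally show ?thesis .
  qed
  have odd_step: "ut \<rhd> T a = qint (int (2 * a + 2)) *s S (Suc a) + qint (int (2 * a + 1)) *s S a" for a
  proof -
    \<comment> \<open>The contribution of \<open>F\<close>, indexed by its target \<open>2 * k\<close>. For \<open>k = 0\<close> the factor
      \<open>qint 0 = 0\<close> compensates for \<open>k - 1 = 0\<close>.\<close>
    define g where "g k = (qint (int (2 * k)) * ?o a (k - 1)) *s Fv (2 * k)" for k
    have *: "g k + (down_coeff (2 * k) * ?o a k) *s Fv (2 * k) =
        (qint (int (2 * a + 2)) * ?e (Suc a) k + qint (int (2 * a + 1)) * ?e a k) *s Fv (2 * k)"
      if "k \<le> a" for k
    proof (cases "k \<le> l")
      case False
      then show ?thesis by (simp add: g_def Fv_eq_0 \<mu>)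
    next
      case True
      then obtain m where l: "l = k + m" using le_Suc_ex by blast
      obtain c where a: "a = k + c" using \<open>k \<le> a\<close> le_Suc_ex by blast
      have "down_coeff (2 * k) = q powi (2 * int k - 2 * int m) * qint (int (2 * m + 1))"
        unfolding down_coeff_l l by (simp add: algebra_simps)
      moreover have "g k = (qint (int (2 * k)) * odd_coeff (Suc m) (Suc c)) *s Fv (2 * k)"
        by (cases k) (simp_all add: g_def l a)
      ultimately show ?thesis
        using coeff_identity_odd[of k m c] unfolding l a
        by (simp add: Suc_diff_le add.commute flip: scale_left_distrib)
    qed
    have "(\<Sum>k\<le>a. (qint (int (2 * k + 2)) * ?o a k) *s Fv (2 * k + 2)) = (\<Sum>k\<le>a. g (Suc k))"
      by (simp add: g_def)
    also have "\<dots> = (\<Sum>k\<le>a. g k) + g (Suc a)"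
      using sum.atMost_Suc[of g a] sum.atMost_Suc_shift[of g a] by (simp add: g_def)
    finally have "ut \<rhd> T a = (\<Sum>k\<le>a. g k + (down_coeff (2 * k) * ?o a k) *s Fv (2 * k)) + g (Suc a)"
      unfolding T_def ut_odd_sum by (simp add: sum.distrib algebra_simps)
    also have "\<dots> = (\<Sum>k\<le>a. (qint (int (2 * a + 2)) * ?e (Suc a) k + qint (int (2 * a + 1)) * ?e a k) *s Fv (2 * k))
        + g (Suc a)"
      by (intro arg_cong2[where f = "(+)"] sum.cong * HOL.refl) simp
    also have "\<dots> = qint (int (2 * a + 2)) *s S (Suc a) + qint (int (2 * a + 1)) *s S a"
      by (simp add: S_def g_def scale_right_distrib scale_left_distrib scale_sum_right sum.distrib)
    finally show ?thesis .
  qed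
  have odd_if_even: "t_odd (2 * a + 1) \<rhd> v = T a" if "t_odd (2 * a) \<rhd> v = S a" for a
  proof -
    have "qint (int (2 * a + 1)) *s (t_odd (2 * a + 1) \<rhd> v) = (ut * t_odd (2 * a)) \<rhd> v"
      unfolding ut_t_odd_even by (simp add: act_mult act_const algebra_simps)
    also have "\<dots> = qint (int (2 * a + 1)) *s T a"
      using that by (simp add: act_mult even_step)
    finally show ?thesis by (rule scale_left_imp_eq[rotated]) simp
  qed
  have "t_odd (2 * a) \<rhd> v = S a" for a
  proof (induction a)
    case 0
    then show ?case by (simp add: S_def act_1 Fv_0)
  next
    case (Suc a)
    have "qint (int (2 * a + 2)) *s (t_odd (2 * a + 2) \<rhd> v) + qint (int (2 * a + 1)) *s S a
        = (ut * t_odd (2 * a + 1)) \<rhd> v"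
      unfolding ut_t_odd_odd by (simp add: act_mult act_const act_add_left add.commute flip: Suc)
    also have "\<dots> = qint (int (2 * a + 2)) *s S (Suc a) + qint (int (2 * a + 1)) *s S a"
      using odd_if_even[OF Suc] by (simp add: act_mult odd_step)
    finally have "qint (int (2 * a + 2)) *s (t_odd (2 * a + 2) \<rhd> v) = qint (int (2 * a + 2)) *s S (Suc a)"
      by simp
    then have "t_odd (2 * a + 2) \<rhd> v = S (Suc a)" by (rule scale_left_imp_eq[rotated]) simp
    then show ?case by simp
  qed
  then show "t_odd (2 * a) \<rhd> v = (\<Sum>k\<le>a. ?e a k *s Fv (2 * k))"
    and "t_odd (2 * a + 1) \<rhd> v = (\<Sum>k\<le>a. ?o a k *s Fv (2 * k + 1))"
    using odd_if_even by (simp_all add: S_def T_def)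
qed

text \<open>For \<open>a > l\<close> each term has a vanishing factor: \<open>F\<^sup>(\<^sup>r\<^sup>) v\<close> if \<open>k > l\<close>, and otherwise the Gaussian
  binomial, as \<open>l - k < a - k\<close>.\<close>

lemma t_odd_vanish:
  assumes \<mu>: "\<mu> = 2 * l + 1" and n: "n > \<mu>"
  shows "t_odd n \<rhd> v = 0"
proof -
  have 0: "even_coeff (l - k) (a - k) *s Fv (2 * k) = 0" "odd_coeff (l - k) (a - k) *s Fv (2 * k + 1) = 0"
    if "a > l" for a k
    using that by (cases "k \<le> l"; simp add: even_odd_coeff_eq_0 Fv_eq_0 \<mu>)+
  show ?thesis
  proof (cases "even n")
    case True
    then obtain a where a: "n = 2 * a" by blast
    then have "a > l" using n \<mu> by simp
    then show ?thesis unfolding a t_odd_expansion[OF \<mu>] by (intro sum.neutral ballI 0)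
  next
    case False
    then obtain a where a: "n = 2 * a + 1" using oddE by blast
    then have "a > l" using n \<mu> by simp
    then show ?thesis unfolding a t_odd_expansion[OF \<mu>] by (intro sum.neutral ballI 0)
  qed
qed

text \<open>Combinations of the first \<open>n\<close> canonical basis vectors with coefficients in
  \<open>q\<^sup>-\<^sup>1\<int>[q\<^sup>-\<^sup>1]\<close>: the error terms allowed in the definition of the \<open>\<iota>\<close>-canonical basis.\<close>

definition lattice_below :: "nat \<Rightarrow> 'v set" where
  "lattice_below n = {\<Sum>r<n. c r *s Fv r | c. \<forall>r. c r \<in> qinv_int_polys}"

lemma lattice_below_diff:
  assumes "y \<in> lattice_below n" "z \<in> lattice_below n"
  shows "y - z \<in> lattice_below n"
proof -
  obtain c d where "y = (\<Sum>r<n. c r *s Fv r)" "z = (\<Sum>r<n. d r *s Fv r)"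
    and cd: "\<And>r. c r \<in> qinv_int_polys" "\<And>r. d r \<in> qinv_int_polys"
    using assms unfolding lattice_below_def by blast
  then have "y - z = (\<Sum>r<n. (c r - d r) *s Fv r)"
    by (simp add: scale_left_diff_distrib sum_subtractf)
  then show ?thesis unfolding lattice_below_def using qinv_int_polys_diff[OF cd]
    by (intro CollectI exI[of _ "\<lambda>r. c r - d r"]) auto
qed

lemma lattice_below_0: "0 \<in> lattice_below n"
  unfolding lattice_below_def by (auto intro!: exI[of _ "\<lambda>_. 0"])

lemma lattice_below_add: "y \<in> lattice_below n \<Longrightarrow> z \<in> lattice_below n \<Longrightarrow> y + z \<in> lattice_below n"
  using lattice_below_diff[of y n "0 - z"] lattice_below_diff[of 0 n z] lattice_below_0 by simp

lemma lattice_below_mono: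
  assumes "y \<in> lattice_below m" "m \<le> n"
  shows "y \<in> lattice_below n"
proof -
  obtain c where c: "y = (\<Sum>r<m. c r *s Fv r)" "\<And>r. c r \<in> qinv_int_polys"
    using assms unfolding lattice_below_def by blast
  have "y = (\<Sum>r<n. (if r < m then c r else 0) *s Fv r)"
    unfolding c(1) using assms(2) by (intro sum.mono_neutral_cong_left) auto
  moreover have "(if r < m then c r else 0) \<in> qinv_int_polys" for r using c(2) by simp
  ultimately show ?thesis
    unfolding lattice_below_def by (intro CollectI exI[of _ "\<lambda>r. if r < m then c r else 0"]) auto
qed

lemma lattice_below_single:
  assumes "c \<in> qinv_int_polys" "r < n"
  shows "c *s Fv r \<in> lattice_below n"
proof -
  have "c *s Fv r = (\<Sum>i<n. (if i = r then c else 0) *s Fv i)"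
    using assms(2) by (simp add: if_distrib[of "\<lambda>c. c *s _"] sum.delta cong: if_cong)
  then show ?thesis
    unfolding lattice_below_def using assms(1)
    by (intro CollectI exI[of _ "\<lambda>i. if i = r then c else 0"]) auto
qed

lemma lattice_below_sum: "(\<And>i. i \<in> I \<Longrightarrow> f i \<in> lattice_below n) \<Longrightarrow> sum f I \<in> lattice_below n"
  by (induction I rule: infinite_finite_induct) (auto intro: lattice_below_0 lattice_below_add)

lemma lattice_below_span: "lattice_below n \<subseteq> span (Fv ` {..<n})"
  unfolding lattice_below_def by (auto intro!: span_sum span_scale intro: span_base)

lemma t_odd_minus_Fv_lattice:
  assumes \<mu>: "\<mu> = 2 * l + 1"
  shows "t_odd n \<rhd> v - Fv n \<in> lattice_below n"
proof (cases "even n")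
  case True
  then obtain a where n: "n = 2 * a" by blast
  have "t_odd n \<rhd> v - Fv n = (\<Sum>k<a. even_coeff (l - k) (a - k) *s Fv (2 * k))"
    unfolding n t_odd_expansion[OF \<mu>] by (simp flip: lessThan_Suc_atMost)
  then show ?thesis
    by (auto simp: n intro!: lattice_below_sum lattice_below_single even_odd_coeff_qinv)
next
  case False
  then obtain a where n: "n = 2 * a + 1" using oddE by blast
  have "t_odd n \<rhd> v - Fv n = (\<Sum>k<a. odd_coeff (l - k) (a - k) *s Fv (2 * k + 1))"
    unfolding n t_odd_expansion[OF \<mu>] by (simp flip: lessThan_Suc_atMost)
  then show ?thesis
    unfolding n by (auto intro!: lattice_below_sum lattice_below_single even_odd_coeff_qinv)
qed

end


section \<open>The bar involution and the \<open>\<iota>\<close>-canonical basis\<close>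

lemma bar_divide: "d \<noteq> 0 \<Longrightarrow> bar (c / d) * bar d = bar c"
  using bar_mult[of "c / d" d] by simp

text \<open>Fixes the odd highest weight, so that the vectors \<open>tv n\<close> are unitriangular over the canonical
  basis.\<close>

locale uq_simple_hw_odd = uq_simple_hw scale M act \<mu> v
  for scale :: "ratfun \<Rightarrow> 'v::ab_group_add \<Rightarrow> 'v" (infixr \<open>*s\<close> 75)
    and M :: "'v set"
    and act :: "uq \<Rightarrow> 'v \<Rightarrow> 'v" (infixr \<open>\<rhd>\<close> 75)
    and \<mu> :: nat and v :: 'v +
  fixes l :: nat
  assumes \<mu>_odd: "\<mu> = 2 * l + 1"
begin

definition tv :: "nat \<Rightarrow> 'v" where
  "tv n = t_odd n \<rhd> v"

lemma tv_in_M [simp]: "tv n \<in> M"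
  by (simp add: tv_def)

lemma tv_minus_Fv: "tv n - Fv n \<in> lattice_below n"
  unfolding tv_def by (rule t_odd_minus_Fv_lattice[OF \<mu>_odd])

lemma span_tv_lessThan: "span (tv ` {..<n}) = span (Fv ` {..<n})"
proof (induction n)
  case (Suc n)
  have z: "tv n - Fv n \<in> span (Fv ` {..<n})"
    using tv_minus_Fv lattice_below_span by blast
  have "span (tv ` {..<Suc n}) = {x. \<exists>k. x - k *s tv n \<in> span (Fv ` {..<n})}"
    by (simp add: lessThan_Suc span_insert Suc)
  also have "\<dots> = {x. \<exists>k. x - k *s Fv n \<in> span (Fv ` {..<n})}"
  proof -
    have "x - k *s tv n \<in> span (Fv ` {..<n}) \<longleftrightarrow> x - k *s Fv n \<in> span (Fv ` {..<n})" for x k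
    proof -
      have "x - k *s Fv n = k *s (tv n - Fv n) + (x - k *s tv n)"
        by (simp add: scale_right_diff_distrib)
      then show ?thesis using span_add_eq[OF span_scale[OF z], of k "x - k *s tv n"] by (simp only:)
    qed
    then show ?thesis by simp
  qed
  also have "\<dots> = span (Fv ` {..<Suc n})" by (simp add: lessThan_Suc span_insert)
  finally show ?case .
qed simp

lemma span_tv: "span (tv ` {..\<mu>}) = M"
  using span_tv_lessThan[of "Suc \<mu>"] by (simp only: lessThan_Suc_atMost span_Fv)

text \<open>Unitriangularity carries the independence of the canonical basis over to the \<open>tv n\<close>.\<close>

lemma tv_notin_span:
  assumes "n \<le> \<mu>"
  shows "tv n \<notin> span (tv ` {..<n})"
proof
  assume *: "tv n \<in> span (tv ` {..<n})"
  have "tv n - Fv n \<in> span (Fv ` {..<n})"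
    using tv_minus_Fv lattice_below_span by blast
  from span_diff[OF *[unfolded span_tv_lessThan] this] have "Fv n \<in> span (Fv ` {..<n})" by simp
  then show False using Fv_notin_span[OF Fv_nonzero[OF assms], of "{..<n}"] by simp
qed

lemma tv_basis: "inj_on tv {..\<mu>} \<and> independent (tv ` {..\<mu>})"
proof -
  have "inj_on tv {..<n} \<and> independent (tv ` {..<n})" if "n \<le> Suc \<mu>" for n
    using that
  proof (induction n)
    case (Suc n)
    then have IH: "inj_on tv {..<n}" "independent (tv ` {..<n})" by simp_all
    have span: "tv n \<notin> span (tv ` {..<n})" using tv_notin_span Suc.prems by simp
    then have "tv n \<notin> tv ` {..<n}" by (metis span_base)
    then have "inj_on tv (insert n {..<n})" using IH(1) by (subst inj_on_insert) auto
    moreover have "independent (insert (tv n) (tv ` {..<n}))"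
      by (rule independent_insertI[OF span IH(2)])
    ultimately show ?case unfolding lessThan_Suc image_insert by (rule conjI)
  qed (simp add: independent_empty)
  from this[OF order_refl] show ?thesis unfolding lessThan_Suc_atMost .
qed

lemma tv_combination_eq_0:
  assumes T: "finite T" "T \<subseteq> {..\<mu>}" and sum: "(\<Sum>n\<in>T. d n *s tv n) = 0" and n: "n \<in> T"
  shows "d n = 0"
proof -
  have inj: "inj_on tv T" using tv_basis T(2) inj_on_subset by blast
  have "(\<Sum>y\<in>tv ` T. d (the_inv_into T tv y) *s y) = (\<Sum>n\<in>T. d n *s tv n)"
    using inj by (simp add: sum.reindex the_inv_into_f_f)
  then have "d (the_inv_into T tv (tv n)) = 0"
    using sum n T tv_basis
    by (intro independentD[of "tv ` {..\<mu>}" "tv ` T"]) auto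
  then show ?thesis using inj n by (simp add: the_inv_into_f_f)
qed

text \<open>The defining conditions of \<open>bar_map\<close> speak only of rational scalars and of \<open>q\<close>; they give
  polynomials in \<open>q\<close> by induction, and fractions by cancelling the conjugate of the denominator.\<close>

lemma bar_map_scale:
  assumes \<psi>: "bar_map \<psi>" and x: "x \<in> M"
  shows "\<psi> (c *s x) = bar c *s \<psi> x"
proof -
  have add: "\<psi> (x + y) = \<psi> x + \<psi> y" if "x \<in> M" "y \<in> M" for x y
    using \<psi> that by (auto simp: bar_map_def)
  have rat: "\<psi> (of_rat r *s x) = of_rat r *s \<psi> x"
    and q: "\<psi> (q *s x) = inverse q *s \<psi> x" if "x \<in> M" for r x
    using \<psi> that by (auto simp: bar_map_def)
  have 0: "\<psi> 0 = 0" using add[of 0 0] by simp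
  have poly: "\<psi> (ev q p *s x) = ev (inverse q) p *s \<psi> x" if "x \<in> M" for p x
    using that
  proof (induction p arbitrary: x)
    case (pCons a p)
    have "\<psi> (ev q (pCons a p) *s x) = \<psi> (of_rat a *s x + q *s (ev q p *s x))"
      by (simp add: ev_pCons scale_left_distrib)
    also have "\<dots> = of_rat a *s \<psi> x + inverse q *s \<psi> (ev q p *s x)"
      using pCons.prems by (simp add: add rat q del: scale_scale)
    also have "\<dots> = ev (inverse q) (pCons a p) *s \<psi> x"
      using pCons by (simp add: ev_pCons scale_left_distrib)
    finally show ?case .
  qed (simp add: 0)
  obtain a b where b: "b \<noteq> 0" and "c = Fract a b" by (cases c) auto
  then have c: "c = ev q a / ev q b" by (simp add: ev_q to_fract_def)
  have nz: "ev q b \<noteq> 0" "ev (inverse q) b \<noteq> 0"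
    using b by (simp_all add: ev_q ev_inverse_q_eq_0_iff)
  have bar_c: "ev (inverse q) b * bar c = ev (inverse q) a"
    using bar_divide[of "ev q b" "ev q a"] nz by (simp add: c mult.commute)
  have "ev (inverse q) b *s \<psi> (c *s x) = \<psi> (ev q b *s (c *s x))"
    by (simp add: poly x del: scale_scale)
  also have "\<dots> = \<psi> (ev q a *s x)" using nz by (simp add: c)
  also have "\<dots> = ev (inverse q) b *s (bar c *s \<psi> x)"
    by (simp add: poly x bar_c)
  finally show ?thesis using nz by (metis scale_left_imp_eq)
qed

lemma bar_map_unique:
  assumes "bar_map \<psi>" "bar_map \<phi>" "x \<in> M"
  shows "\<psi> x = \<phi> x"
proof -
  have "x \<in> span (tv ` {..\<mu>})" using assms(3) by (simp add: span_tv)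
  then have "x \<in> M \<and> \<psi> x = \<phi> x"
  proof (induction rule: span_induct_alt)
    case base
    then show ?case
      using bar_map_scale[OF assms(1), of 0 0] bar_map_scale[OF assms(2), of 0 0] by simp
  next
    case (step c s y)
    then obtain n where "s = tv n" by blast
    then have "\<psi> s = \<phi> s" "s \<in> M" using assms(1,2) by (auto simp: bar_map_def tv_def)
    moreover have "\<psi> (c *s s + y) = \<psi> (c *s s) + \<psi> y" "\<phi> (c *s s + y) = \<phi> (c *s s) + \<phi> y"
      using assms(1,2) \<open>s \<in> M\<close> step by (auto simp: bar_map_def)
    ultimately show ?case using step by (simp add: bar_map_scale assms)
  qed
  then show ?thesis ..
qed

definition bar_inv :: "'v \<Rightarrow> 'v" where
  "bar_inv x = (\<Sum>n\<le>\<mu>. bar (representation (tv ` {..\<mu>}) x (tv n)) *s tv n)"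

lemma bar_map_exists: "bar_map bar_inv"
proof -
  let ?B = "tv ` {..\<mu>}"
  have B: "independent ?B" and inj: "inj_on tv {..\<mu>}" using tv_basis by auto
  have add: "bar_inv (x + y) = bar_inv x + bar_inv y" if "x \<in> M" "y \<in> M" for x y
    using that by (simp add: bar_inv_def span_tv representation_add[OF B] bar_add scale_left_distrib
        sum.distrib)
  have scale: "bar_inv (c *s x) = bar c *s bar_inv x" if "x \<in> M" for c x
    using that by (simp add: bar_inv_def span_tv representation_scale[OF B] bar_mult scale_sum_right)
  have fixed: "bar_inv (tv n) = tv n" for n
  proof (cases "n \<le> \<mu>")
    case True
    have "bar_inv (tv n) = (\<Sum>m\<le>\<mu>. (if m = n then tv n else 0))"
      unfolding bar_inv_def
    proof (rule sum.cong)
      fix m assume "m \<in> {..\<mu>}"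
      then have "tv m = tv n \<longleftrightarrow> m = n" using inj True by (auto dest: inj_onD)
      then show "bar (representation ?B (tv n) (tv m)) *s tv m = (if m = n then tv n else 0)"
        using representation_basis[OF B, of "tv n"] True by auto
    qed simp
    then show ?thesis using True by simp
  next
    case False
    then have "tv n = 0" unfolding tv_def by (intro t_odd_vanish[OF \<mu>_odd]) simp
    then show ?thesis using scale[of 0 0] by simp
  qed
  have "bar_inv x \<in> M" for x by (simp add: bar_inv_def M_sum)
  then show ?thesis unfolding bar_map_def
    using add scale fixed by (simp add: bar_of_rat bar_q flip: tv_def)
qed

lemma bar_map_span_tv:
  assumes \<psi>: "bar_map \<psi>" and y: "y \<in> span (tv ` {..<n})"
  shows "\<psi> y \<in> span (tv ` {..<n})"
proof -
  have "y \<in> M \<and> \<psi> y \<in> span (tv ` {..<n})"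
    using y
  proof (induction rule: span_induct_alt)
    case base
    then show ?case using bar_map_scale[OF \<psi>, of 0 0] by (simp add: span_zero)
  next
    case (step c s y)
    obtain m where m: "s = tv m" "m < n" using step(1) by auto
    then have "\<psi> (c *s s + y) = bar c *s tv m + \<psi> y"
      using \<psi> step bar_map_scale[OF \<psi>, of s c] by (simp add: bar_map_def tv_def)
    then show ?case using m step by (auto intro!: span_add span_scale intro: span_base)
  qed
  then show ?thesis ..
qed

text \<open>Uniqueness of the \<open>\<iota>\<close>-canonical basis. By unitriangularity, the top coefficient \<open>c n\<close> of \<open>w\<close> is
  also its top coefficient over the \<open>tv n\<close>. These are fixed by \<open>\<psi>\<close>, so \<open>c n\<close> is fixed by \<open>bar\<close> and
  therefore \<open>0\<close>, and the induction descends.\<close>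

lemma bar_fixed_lattice:
  assumes \<psi>: "bar_map \<psi>" and "w \<in> lattice_below n" "n \<le> Suc \<mu>" "\<psi> w = w"
  shows "w = 0"
  using assms(2-4)
proof (induction n arbitrary: w)
  case 0
  then show ?case by (simp add: lattice_below_def)
next
  case (Suc n)
  obtain c where c: "\<And>r. c r \<in> qinv_int_polys" and w: "w = (\<Sum>r<Suc n. c r *s Fv r)"
    using Suc.prems(1) unfolding lattice_below_def by blast
  define y where "y = (\<Sum>r<n. c r *s Fv r) - c n *s (tv n - Fv n)"
  have y: "y \<in> span (tv ` {..<n})"
    unfolding span_tv_lessThan y_def
    by (rule span_diff[OF span_sum span_scale[OF subsetD[OF lattice_below_span tv_minus_Fv]]])
      (auto intro!: span_scale intro: span_base)
  have w_y: "w = c n *s tv n + y"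
    by (simp add: w y_def scale_right_diff_distrib)
  have "span (tv ` {..<n}) \<subseteq> M" by (rule span_minimal) (auto intro: subspace_carrier)
  then have "y \<in> M" using y by blast
  then have "\<psi> w = bar (c n) *s tv n + \<psi> y"
    using \<psi> bar_map_scale[OF \<psi>, of "tv n" "c n"] by (simp add: w_y bar_map_def tv_def)
  then have "(c n - bar (c n)) *s tv n = \<psi> y - y"
    using Suc.prems(3) w_y by (simp add: scale_left_diff_distrib algebra_simps)
  also have "\<dots> \<in> span (tv ` {..<n})"
    using y bar_map_span_tv[OF \<psi> y] by (rule span_diff[rotated])
  finally have *: "(c n - bar (c n)) *s tv n \<in> span (tv ` {..<n})" .
  have "bar (c n) = c n"
  proof (rule ccontr)
    assume "bar (c n) \<noteq> c n"
    then have "tv n \<in> span (tv ` {..<n})"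
      using span_scale[OF *, of "inverse (c n - bar (c n))"] by simp
    then show False using tv_notin_span[of n] Suc.prems(2) by simp
  qed
  then have "c n = 0" using bar_fixed_qinv_int_polys c by blast
  then have "w \<in> lattice_below n" unfolding lattice_below_def w using c by auto
  then show ?case using Suc by simp
qed

lemma icb_conditions_tv:
  assumes \<psi>: "bar_map \<psi>"
  shows "icb_conditions \<psi> tv"
proof -
  have "\<exists>c. (\<forall>r \<le> \<mu>. c r \<in> qinv_int_polys) \<and>
        tv a = F_divpow a \<rhd> v + (\<Sum>r \<le> \<mu>. c r *s (F_divpow r \<rhd> v))" if "a \<le> \<mu>" for a
  proof -
    have "tv a - Fv a \<in> lattice_below (Suc \<mu>)"
      using lattice_below_mono[OF tv_minus_Fv] that by simp
    then obtain c where "\<And>r. c r \<in> qinv_int_polys" "tv a - Fv a = (\<Sum>r\<le>\<mu>. c r *s Fv r)"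
      unfolding lattice_below_def lessThan_Suc_atMost by blast
    then show ?thesis
      by (intro exI[of _ c]) (simp add: algebra_simps flip: Fv_def)
  qed
  then show ?thesis
    using \<psi> tv_basis span_tv unfolding icb_conditions_def by (simp add: bar_map_def tv_def)
qed

text \<open>Two candidates for the \<open>a\<close>-th basis vector have the same leading term, so their difference is a
  bar-invariant error term.\<close>

lemma icb_conditions_unique:
  assumes \<psi>: "bar_map \<psi>" and b: "icb_conditions \<psi> b" and a: "a \<le> \<mu>"
  shows "b a = tv a"
proof -
  obtain c where c: "\<And>r. r \<le> \<mu> \<Longrightarrow> c r \<in> qinv_int_polys"
    and b_c: "b a = Fv a + (\<Sum>r\<le>\<mu>. c r *s Fv r)"
    using b a unfolding icb_conditions_def Fv_def by blast
  have "b a - Fv a \<in> lattice_below (Suc \<mu>)"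
    unfolding b_c using c by (auto intro!: lattice_below_sum lattice_below_single)
  moreover have "tv a - Fv a \<in> lattice_below (Suc \<mu>)"
    using lattice_below_mono[OF tv_minus_Fv] a by simp
  ultimately have "b a - Fv a - (tv a - Fv a) \<in> lattice_below (Suc \<mu>)"
    by (rule lattice_below_diff)
  then have lat: "b a - tv a \<in> lattice_below (Suc \<mu>)" by simp
  have M: "b a \<in> M" unfolding b_c by (simp add: M_sum)
  have "\<psi> ((b a - tv a) + tv a) = \<psi> (b a - tv a) + \<psi> (tv a)"
    using \<psi> M unfolding bar_map_def by (metis M_simps(5) tv_in_M)
  moreover have "\<psi> (b a) = b a" using b a by (simp add: icb_conditions_def)
  moreover have "\<psi> (tv a) = tv a" using \<psi> by (simp add: bar_map_def tv_def)
  ultimately have "\<psi> (b a - tv a) = b a - tv a" by (simp add: algebra_simps)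
  then show ?thesis using bar_fixed_lattice[OF \<psi> lat] by simp
qed

lemma icanonical_basis_tv: "icanonical_basis tv"
  unfolding icanonical_basis_def bar_involution_def
  using bar_map_exists bar_map_unique icb_conditions_tv icb_conditions_unique by blast

end

section \<open>The two parts of the theorem\<close>

context uq_simple_hw
begin

lemma icanonical_basis_t_odd:
  assumes "\<mu> = 2 * l + 1"
  shows "icanonical_basis (\<lambda>n. t_odd n \<rhd> v)"
proof -
  interpret uq_simple_hw_odd scale M act \<mu> v l by unfold_locales (rule assms)
  show ?thesis using icanonical_basis_tv by (simp add: tv_def[abs_def])
qed

lemma t_odd_combination_eq_0:
  assumes "\<mu> = 2 * l + 1" and "finite T" "T \<subseteq> {..\<mu>}"
    and "(\<Sum>n\<in>T. d n *s (t_odd n \<rhd> v)) = 0" "n \<in> T"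
  shows "d n = 0"
proof -
  interpret uq_simple_hw_odd scale M act \<mu> v l by unfold_locales (rule assms)
  show ?thesis using tv_combination_eq_0[of T d n] assms by (simp add: tv_def)
qed

end

theorem theorem3p6:
  fixes scale :: "ratfun \<Rightarrow> 'v::ab_group_add \<Rightarrow> 'v"
    and L :: "nat \<Rightarrow> 'v set"
    and act :: "nat \<Rightarrow> uq \<Rightarrow> 'v \<Rightarrow> 'v"
    and v :: "nat \<Rightarrow> 'v"
  assumes L: "\<And>\<mu>. uq_simple_hw scale (L \<mu>) (act \<mu>) \<mu> (v \<mu>)"
  shows "(\<forall>l. uq_simple_hw.icanonical_basis_set scale (L (2 * l + 1)) (act (2 * l + 1))
               (2 * l + 1) (v (2 * l + 1))
               {act (2 * l + 1) (t_odd n) (v (2 * l + 1)) | n. n \<le> 2 * l + 1} \<and>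
             (\<forall>n > 2 * l + 1. act (2 * l + 1) (t_odd n) (v (2 * l + 1)) = 0)) \<and>
         icanonical_basis_uiota_odd scale L act v (range t_odd)"
proof -
  define b where "b l n = act (2 * l + 1) (t_odd n) (v (2 * l + 1))" for l n
  have icb: "uq_simple_hw.icanonical_basis scale (L (2 * l + 1)) (act (2 * l + 1))
        (2 * l + 1) (v (2 * l + 1)) (b l)" for l
    unfolding b_def[abs_def] using uq_simple_hw.icanonical_basis_t_odd[OF L HOL.refl] .
  have sets: "uq_simple_hw.icanonical_basis_set scale (L (2 * l + 1)) (act (2 * l + 1))
      (2 * l + 1) (v (2 * l + 1)) {act (2 * l + 1) (t_odd n) (v (2 * l + 1)) | n. n \<le> 2 * l + 1}" for l
    unfolding uq_simple_hw.icanonical_basis_set_def[OF L]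
    by (rule exI[of _ "b l"], intro conjI, rule icb) (auto simp: b_def)
  \<comment> \<open>An element of \<open>uiota\<close> is determined by its action on the highest weight vectors: it is a finite
    combination of \<open>\<iota>\<close>-divided powers, and these act independently as soon as \<open>2 * l + 1\<close>
    exceeds all of their indices.\<close>
  have faithful: "w = t_odd a"
    if w: "w \<in> uiota" and ev: "\<forall>\<^sub>F l in sequentially. act (2 * l + 1) w (v (2 * l + 1)) = b l a" for a w
  proof -
    have "w - t_odd a \<in> uq.span (range t_odd)"
      using w uiota_subset_span by (intro uq.span_diff) (auto intro: uq.span_base)
    then obtain T d where T: "finite T" and d: "w - t_odd a = (\<Sum>n\<in>T. uconst (d n) * t_odd n)"
      using uq.span_image_explicit[of _ t_odd UNIV] by blast
    obtain N where N: "\<And>l. l \<ge> N \<Longrightarrow> act (2 * l + 1) w (v (2 * l + 1)) = b l a"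
      using ev unfolding eventually_sequentially by blast
    obtain k where k: "\<And>n. n \<in> T \<Longrightarrow> n \<le> k"
      using T by (meson finite_nat_set_iff_bounded_le)
    define l where "l = max N k"
    define \<mu> where "\<mu> = 2 * l + 1"
    interpret m: uq_simple_hw scale "L \<mu>" "act \<mu>" \<mu> "v \<mu>" by (rule L)
    have eq: "(\<Sum>n\<in>T. scale (d n) (act \<mu> (t_odd n) (v \<mu>))) = act \<mu> (w - t_odd a) (v \<mu>)"
      unfolding d by (simp add: m.act_sum_left m.act_mult m.act_const)
    have "act \<mu> w (v \<mu>) = act \<mu> (t_odd a) (v \<mu>)"
      using N[of l] unfolding b_def \<mu>_def l_def by simp
    then have "act \<mu> (w - t_odd a) (v \<mu>) = 0" by (simp add: m.act_diff_left)
    with eq have sum_0: "(\<Sum>n\<in>T. scale (d n) (act \<mu> (t_odd n) (v \<mu>))) = 0" by (simp only:)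
    have "n \<le> \<mu>" if "n \<in> T" for n
      using k[OF that] by (simp add: l_def \<mu>_def)
    then have "d n = 0" if "n \<in> T" for n
      using m.t_odd_combination_eq_0[OF \<mu>_def T _ sum_0 that] by blast
    then have "w - t_odd a = 0" unfolding d by (simp add: uconst_simps)
    then show ?thesis by simp
  qed
  have "icanonical_basis_uiota_odd scale L act v (range t_odd)"
    unfolding icanonical_basis_uiota_odd_def
    using icb faithful t_odd_in_uiota
    by (intro exI[of _ b] exI[of _ t_odd]) (auto simp: b_def)
  then show ?thesis using sets uq_simple_hw.t_odd_vanish[OF L HOL.refl] by blast
qed

end
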